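(* Let $A\subseteq\mathbb{C}$ be a finite set with $|A|\ge2$. Then \[|[A,A,0][A,A,0]|\gtrsim |A|^{29/8}=|[A,A,0]|^{29/16}.\]
   Context: The Heisenberg group $H_1(\mathbb{C})$ consists of the matrices $[x,y,z]=\begin{bmatrix}1&x&z\\0&1&y\\0&0&1\end{bmatrix}$, $x,y,z\in\mathbb{C}$, with matrix multiplication, so $[x,y,z][x',y',z']=[x+x',y+y',z+z'+xy']$. $[A,A,0]=\{[x,y,0]:x,y\in A\}$ (so $|[A,A,0]|=|A|^2$) and $[A,A,0][A,A,0]=\{mm':m,m'\in[A,A,0]\}$. Notation: $X\ll Y$ means $X\le CY$ for an absolute constant $C>0$; $X\lesssim Y$ means $X\ll(\log Y)^{C'}Y$ for some absolute constant $C'>0$; $X\gtrsim Y$ means $Y\lesssim X$. *)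

theory Defs
  imports "HOL-Analysis.Analysis"
begin

definition heis :: "complex \<Rightarrow> complex \<Rightarrow> complex \<Rightarrow> complex ^ 3 ^ 3" where
  "heis x y z = vector [vector [1, x, z], vector [0, 1, y], vector [0, 0, 1]]"

lemma heis_mult: "heis x y z ** heis x' y' z' = heis (x + x') (y + y') (z + z' + x * y')"
  by (simp add: heis_def matrix_matrix_mult_def vec_eq_iff forall_3 sum_3 algebra_simps)

definition heis_slice :: "complex set \<Rightarrow> (complex ^ 3 ^ 3) set" where
  "heis_slice A = {heis x y 0 | x y. x \<in> A \<and> y \<in> A}"

definition mat_set_prod :: "(complex ^ 3 ^ 3) set \<Rightarrow> (complex ^ 3 ^ 3) set \<Rightarrow> (complex ^ 3 ^ 3) set" where
  "mat_set_prod S T = {m ** m' | m m'. m \<in> S \<and> m' \<in> T}"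

end

theory Submission
  imports Defs
begin

text \<open>
  Drop \<open>0\<close> from \<open>A\<close>. By Cauchy--Schwarz it suffices to bound, for large \<open>Y \<subseteq> X \<subseteq> A\<close>, the energy
  \<open>E = (\<Sum>\<mu>. F \<mu> ^ 2)\<close>, where \<open>F \<mu>\<close> is the sum of \<open>r ((\<mu> - 1) * u)\<close> over \<open>u\<close> with \<open>u, \<mu> * u \<in> Y\<close>, and
  \<open>r d\<close> counts the representations of \<open>d\<close> in \<open>X - X\<close>.

  The only geometric input is the Szemeredi--Trotter bound for Cartesian products over the complex
  numbers: on a line a point and its nearest neighbour are close in both coordinates, and a point of
  the plane lies in boundedly many nearest-neighbour discs.

  Split \<open>E\<close> according to the size \<open>\<rho>\<close> of \<open>r\<close>, and let \<open>e\<close> be the number of pairs in \<open>X\<close> whose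
  difference has at least \<open>\<rho>\<close> representations; put \<open>n = card A\<close>. The incidence bound for the lines
  \<open>b = a - \<nu> * u\<close> gives at most \<open>n ^ 6 / t ^ 3\<close> values \<open>\<mu>\<close> with \<open>F \<mu> \<ge> t\<close>, hence a contribution of about
  \<open>n ^ 3 * sqrt (\<rho> * e)\<close>. If every point of \<open>Y\<close> lies in about \<open>e / n\<close> of these pairs, an
  Elekes--Ruzsa argument gives about \<open>n ^ 7 / (\<rho> * e)\<close> instead. The smaller of the two is at most
  \<open>n powr (13/3)\<close>, so the product set has about \<open>n powr (11/3)\<close> elements, and \<open>11/3 > 29/8\<close>
  leaves room for the losses.

  The regularity of \<open>Y\<close> at all of the boundedly many scales \<open>\<rho>\<close> at once comes from choosing \<open>X\<close> to
  minimise the product of the \<open>1 + e\<close> over the scales, divided by a large power of \<open>card X\<close>.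
\<close>

section \<open>Incidences with Cartesian products\<close>

text \<open>Two vectors in the sector \<open>0 \<le> b \<le> a\<close> make an angle of at most 45
  degrees, so twice their inner product exceeds the smaller squared norm. If
  \<open>a \<le> c\<close>, then \<open>a^2 + b^2 \<le> 2 * (a * c)\<close> with equality only for
  \<open>a = b = c\<close>; there, if also \<open>d = 0\<close>, only the second squared norm is
  exceeded.\<close>

lemma same_octant_close:
  fixes a b c d :: real
  assumes "0 \<le> b" "b \<le> a" "0 \<le> d" "d \<le> c" "0 < a" "0 < c"
  shows "2 * (a * c + b * d) > a^2 + b^2 \<or> 2 * (a * c + b * d) > c^2 + d^2"
proof -
  have *: "2 * (a * c + b * d) > a^2 + b^2 \<or> 2 * (a * c + b * d) > c^2 + d^2"
    if h: "0 \<le> b" "b \<le> a" "0 \<le> d" "d \<le> c" "0 < a" "a \<le> c" for a b c d :: real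
  proof (cases "b = a \<and> c = a")
    case True
    have "b * d \<ge> d * d"
      using h True by (intro mult_right_mono) auto
    moreover have "a * a > 0" using h by simp
    ultimately show ?thesis
      using True h by (cases "d = 0") (auto simp: power2_eq_square)
  next
    case False
    have ac: "a * a \<le> a * c" using h by (intro mult_left_mono) auto
    have bb: "b * b \<le> a * a" using h by (intro mult_mono) auto
    have bd: "0 \<le> b * d" using h by simp
    from False consider "b < a" | "a < c" using h by linarith
    then show ?thesis
    proof cases
      case 1
      then have "b * b < a * a" using h by (intro mult_strict_mono') auto
      then show ?thesis using ac bd by (auto simp: power2_eq_square)
    next
      case 2
      then have "a * a < a * c" using h by simp
      then show ?thesis using bb bd by (auto simp: power2_eq_square)
    qed
  qed
  show ?thesis
  proof (cases "a \<le> c")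
    case True then show ?thesis using * assms by blast
  next
    case False
    then show ?thesis using *[of d c b a] assms by (auto simp: mult.commute)
  qed
qed

text \<open>Names one of eight sectors of opening 45 degrees: the signs of both coordinates and
  which of them dominates.\<close>

definition octant :: "complex \<Rightarrow> bool \<times> bool \<times> bool" where
  "octant z = (Re z \<ge> 0, Im z \<ge> 0, \<bar>Im z\<bar> \<le> \<bar>Re z\<bar>)"

text \<open>Law of cosines: the angle is below 60 degrees, so the side opposite to it is shorter
  than the longer of the other two sides.\<close>

lemma octant_close:
  assumes "octant a = octant b" "a \<noteq> 0" "b \<noteq> 0"
  shows "cmod (a - b) < cmod a \<or> cmod (a - b) < cmod b"
proof -
  let ?i = "Re a * Re b + Im a * Im b"
  have ab: "(cmod (a - b))\<^sup>2 = (cmod a)\<^sup>2 + (cmod b)\<^sup>2 - 2 * ?i"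
    by (simp only: cmod_power2 minus_complex.sel) (simp add: power2_eq_square algebra_simps)
  have re: "Re a * Re b = \<bar>Re a\<bar> * \<bar>Re b\<bar>"
    using assms(1) by (auto simp: octant_def abs_if)
  have im: "Im a * Im b = \<bar>Im a\<bar> * \<bar>Im b\<bar>"
    using assms(1) by (auto simp: octant_def abs_if)
  have "2 * ?i > (cmod a)\<^sup>2 \<or> 2 * ?i > (cmod b)\<^sup>2"
  proof (cases "\<bar>Im a\<bar> \<le> \<bar>Re a\<bar>")
    case True
    then have "\<bar>Im b\<bar> \<le> \<bar>Re b\<bar>" using assms(1) by (simp add: octant_def)
    then show ?thesis
      using same_octant_close[of "\<bar>Im a\<bar>" "\<bar>Re a\<bar>" "\<bar>Im b\<bar>" "\<bar>Re b\<bar>"] True assms(2,3)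
      by (auto simp: re im cmod_power2 complex_eq_iff)
  next
    case False
    then have "\<not> \<bar>Im b\<bar> \<le> \<bar>Re b\<bar>" using assms(1) by (simp add: octant_def)
    then show ?thesis
      using same_octant_close[of "\<bar>Re a\<bar>" "\<bar>Im a\<bar>" "\<bar>Re b\<bar>" "\<bar>Im b\<bar>"] False assms(2,3)
      by (auto simp: re im cmod_power2 complex_eq_iff add.commute)
  qed
  then have "(cmod (a - b))\<^sup>2 < (cmod a)\<^sup>2 \<or> (cmod (a - b))\<^sup>2 < (cmod b)\<^sup>2"
    using ab by linarith
  then show ?thesis
    by (meson norm_ge_zero power_less_imp_less_base)
qed

text \<open>By \<open>octant_close\<close>, two nonzero members of one sector would violate the
  separation. This leaves at most eight nonzero members, and possibly 0.\<close>

lemma card_separated_le_9: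
  fixes T :: "complex set"
  assumes "finite T" and sep: "\<And>a b. a \<in> T \<Longrightarrow> b \<in> T \<Longrightarrow> a \<noteq> b \<Longrightarrow> cmod a \<le> cmod (a - b)"
  shows "card T \<le> 9"
proof -
  have "inj_on octant (T - {0})"
  proof (rule inj_onI, rule ccontr)
    fix a b assume h: "a \<in> T - {0}" "b \<in> T - {0}" "octant a = octant b" "a \<noteq> b"
    then show False
      using octant_close[of a b] sep[of a b] sep[of b a] by (auto simp: norm_minus_commute)
  qed
  then have "card (T - {0}) \<le> card (UNIV :: (bool \<times> bool \<times> bool) set)"
    by (metis card_image card_mono finite subset_UNIV)
  also have "\<dots> = 8"
    by (simp add: card_cartesian_product flip: UNIV_Times_UNIV)
  finally show ?thesis
    using \<open>finite T\<close> by (cases "0 \<in> T") auto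
qed

text \<open>After a translation by \<open>z\<close>, the centres of the discs that contain
  \<open>z\<close> are separated as in \<open>card_separated_le_9\<close>; hence every
  \<open>z\<close> is counted at most nine times.\<close>

lemma sum_card_cball_le:
  fixes A K :: "complex set" and \<rho> :: "complex \<Rightarrow> real"
  assumes "finite A" "finite K"
    and sep: "\<And>a b. a \<in> K \<Longrightarrow> b \<in> K \<Longrightarrow> a \<noteq> b \<Longrightarrow> \<rho> a \<le> dist a b"
  shows "(\<Sum>a\<in>K. card (A \<inter> cball a (\<rho> a))) \<le> 9 * card A"
proof -
  have "(\<Sum>a\<in>K. card (A \<inter> cball a (\<rho> a))) = (\<Sum>a\<in>K. \<Sum>z\<in>A. if dist a z \<le> \<rho> a then 1 else 0)"
    using assms by (intro sum.cong refl) (simp add: sum.If_cases Int_def)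
  also have "\<dots> = (\<Sum>z\<in>A. \<Sum>a\<in>K. if dist a z \<le> \<rho> a then 1 else 0)"
    by (rule sum.swap)
  also have "\<dots> = (\<Sum>z\<in>A. card {a\<in>K. dist a z \<le> \<rho> a})"
    using assms by (intro sum.cong refl) (simp add: sum.If_cases Int_def)
  also have "\<dots> \<le> (\<Sum>z\<in>A. 9)"
  proof (rule sum_mono)
    fix z assume "z \<in> A"
    let ?K = "{a\<in>K. dist a z \<le> \<rho> a}"
    have "card ?K = card ((\<lambda>a. a - z) ` ?K)"
      by (rule card_image[symmetric]) (simp add: inj_on_def)
    also have "\<dots> \<le> 9"
    proof (rule card_separated_le_9)
      fix a b assume "a \<in> (\<lambda>a. a - z) ` ?K" "b \<in> (\<lambda>a. a - z) ` ?K" "a \<noteq> b"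
      then obtain a' b' where "a = a' - z" "b = b' - z" "a' \<in> ?K" "b' \<in> ?K" "a' \<noteq> b'" by auto
      then show "cmod a \<le> cmod (a - b)"
        using sep[of a' b'] by (auto simp: dist_norm)
    qed (use assms in auto)
    finally show "card ?K \<le> 9" .
  qed
  also have "\<dots> = 9 * card A" by simp
  finally show ?thesis .
qed

text \<open>For fixed \<open>a\<close> take the farthest admissible \<open>b\<close>: the disc
  through it contains all admissible points and holds at most \<open>q\<close> points of
  \<open>A\<close>.\<close>

lemma card_close_pairs_le:
  fixes A :: "'a::metric_space set" and q :: real
  assumes "finite A" "0 \<le> q"
  shows "real (card {(a, b). a \<in> A \<and> b \<in> A \<and> real (card (A \<inter> cball a (dist a b))) \<le> q}) \<le> card A * q"
proof -
  let ?B = "\<lambda>a. {b\<in>A. real (card (A \<inter> cball a (dist a b))) \<le> q}"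
  have *: "real (card (?B a)) \<le> q" for a
  proof (cases "?B a = {}")
    case False
    have fin: "finite (?B a)" using assms by simp
    obtain b where b: "b \<in> ?B a" "dist a b = Max (dist a ` ?B a)"
      using Max_in[of "dist a ` ?B a"] fin False by (metis (no_types, lifting) finite_imageI image_iff image_is_empty)
    have "?B a \<subseteq> A \<inter> cball a (dist a b)"
      using fin b by (auto simp del: mem_Collect_eq intro!: Max_ge)
    then have "card (?B a) \<le> card (A \<inter> cball a (dist a b))"
      using assms by (intro card_mono) auto
    then show ?thesis using b by simp
  next
    case True
    then show ?thesis using assms by (simp only: True) simp
  qed
  have "{(a, b). a \<in> A \<and> b \<in> A \<and> real (card (A \<inter> cball a (dist a b))) \<le> q} = Sigma A ?B"
    by auto
  then have "real (card {(a, b). a \<in> A \<and> b \<in> A \<and> real (card (A \<inter> cball a (dist a b))) \<le> q})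
     = (\<Sum>a\<in>A. real (card (?B a)))"
    using assms by simp
  also have "\<dots> \<le> (\<Sum>a\<in>A. q)" by (intro sum_mono *)
  finally show ?thesis by simp
qed

lemma card_above_mean_le:
  fixes f :: "'a \<Rightarrow> nat" and s :: real
  assumes "finite K" "(\<Sum>a\<in>K. f a) \<le> 9 * N" "0 < s" "0 < N"
  shows "real (card {a\<in>K. real (f a) > N / s}) \<le> 9 * s"
proof -
  let ?K = "{a\<in>K. real (f a) > N / s}"
  have "card ?K * (N / s) = (\<Sum>a\<in>?K. N / s)" by simp
  also have "\<dots> \<le> (\<Sum>a\<in>?K. real (f a))" by (intro sum_mono) auto
  also have "\<dots> \<le> (\<Sum>a\<in>K. real (f a))"
    using assms by (intro sum_mono2) auto
  also have "\<dots> \<le> 9 * real N" using assms(2) by (metis of_nat_mono of_nat_mult of_nat_numeral of_nat_sum)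
  finally show ?thesis using assms by (simp add: field_simps)
qed

section \<open>Incidences and rich lines on a grid\<close>

text \<open>The pair \<open>(l, c)\<close> stands for the line \<open>y = l * x + c\<close>; its
  incidences with the grid \<open>A \<times> B\<close> are recorded by their abscissae.\<close>

definition line_pts :: "complex set \<Rightarrow> complex set \<Rightarrow> complex \<times> complex \<Rightarrow> complex set" where
  "line_pts A B = (\<lambda>(l, c). {x\<in>A. l * x + c \<in> B})"

lemma finite_line_pts [simp]: "finite A \<Longrightarrow> finite (line_pts A B \<kappa>)"
  by (cases \<kappa>) (simp add: line_pts_def)

text \<open>Szemeredi-Trotter for grids, with a free parameter \<open>s\<close>. A complex line of
  nonzero slope projects to both axes by similarities, so nearest neighbours on it agree in both
  coordinates. By bounded overlap, in each coordinate at most \<open>9 * s\<close> points have a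
  nearest-neighbour disc holding more than the share \<open>1 / s\<close> of that side of the grid.
  Every other point, together with its neighbour, gives a close pair in \<open>A\<close> and a close
  pair in \<open>B\<close>, and these determine the line.\<close>

lemma incidence_bound:
  fixes A B :: "complex set" and s :: real
  assumes fin: "finite A" "finite B" "finite L" and nz: "\<And>l c. (l, c) \<in> L \<Longrightarrow> l \<noteq> 0" and s: "s \<ge> 1"
  shows "(\<Sum>\<kappa>\<in>L. real (card (line_pts A B \<kappa>))) \<le> 19 * s * card L + (real (card A) * real (card B))\<^sup>2 / s\<^sup>2"
proof (cases "A = {} \<or> B = {}")
  case True
  then have "line_pts A B \<kappa> = {}" for \<kappa> by (auto simp: line_pts_def split: prod.split)
  then show ?thesis using s by simp
next
  case False
  then have cA: "card A > 0" and cB: "card B > 0" using fin by auto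
  define P where "P = (\<lambda>(A :: complex set). {(a, b). a \<in> A \<and> b \<in> A \<and> real (card (A \<inter> cball a (dist a b))) \<le> card A / s})"
  \<comment> \<open>The nearest neighbour. The choice is meaningful only if \<open>K\<close> has a
    second point, hence the condition on the cardinality in \<open>good\<close>.\<close>
  define nn where "nn = (\<lambda>K a :: complex. SOME b. b \<in> K - {a} \<and> (\<forall>b'\<in>K - {a}. dist a b \<le> dist a b'))"
  have nn: "nn K a \<in> K - {a} \<and> (\<forall>b'\<in>K - {a}. dist a (nn K a) \<le> dist a b')"
    if "finite K" "card K \<ge> 2" "a \<in> K" for K a
  proof -
    have "K - {a} \<noteq> {}" using that by (metis One_nat_def card.empty card_Suc_Diff1 finite.emptyI not_less_eq_eq numeral_2_eq_2 order_refl zero_le)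
    then have "\<exists>b. b \<in> K - {a} \<and> (\<forall>b'\<in>K - {a}. dist a b \<le> dist a b')"
      using that ex_min_if_finite[of "dist a ` (K - {a})"] by (auto simp: not_less)
    then show ?thesis unfolding nn_def by (rule someI_ex)
  qed
  define good where "good = (\<lambda>\<kappa>. {x \<in> line_pts A B \<kappa>. card (line_pts A B \<kappa>) \<ge> 2 \<and> (x, nn (line_pts A B \<kappa>) x) \<in> P A
      \<and> (fst \<kappa> * x + snd \<kappa>, fst \<kappa> * nn (line_pts A B \<kappa>) x + snd \<kappa>) \<in> P B})"
  \<comment> \<open>Here \<open>19 * s\<close> covers the two exceptional sets of size at most
    \<open>9 * s\<close>, and also the lines with at most one point, since
    \<open>s \<ge> 1\<close>.\<close>
  have each: "real (card (line_pts A B \<kappa>)) \<le> 19 * s + card (good \<kappa>)" if "\<kappa> \<in> L" for \<kappa>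
  proof (cases "card (line_pts A B \<kappa>) \<ge> 2")
    case False
    then have "real (card (line_pts A B \<kappa>)) \<le> 1" by simp
    then show ?thesis using s by linarith
  next
    case True
    obtain l c where lc: "\<kappa> = (l, c)" by force
    define K where "K = line_pts A B \<kappa>"
    have K: "finite K" "card K \<ge> 2" "K \<subseteq> A" "\<And>x. x \<in> K \<Longrightarrow> l * x + c \<in> B"
      using True fin by (auto simp: K_def lc line_pts_def)
    have l0: "l \<noteq> 0" using nz that lc by blast
    define g where "g = (\<lambda>x. l * x + c)"
    have g: "inj g" "\<And>x y. dist (g x) (g y) = cmod l * dist x y"
      using l0 by (auto simp: g_def inj_def dist_norm norm_mult simp flip: right_diff_distrib)
    have nnK: "x \<in> K \<Longrightarrow> nn K x \<in> K \<and> nn K x \<noteq> x" "\<And>y. x \<in> K \<Longrightarrow> y \<in> K \<Longrightarrow> x \<noteq> y \<Longrightarrow> dist x (nn K x) \<le> dist x y" for x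
      using nn[OF K(1,2), of x] by auto
    have "(\<Sum>x\<in>K. card (A \<inter> cball x (dist x (nn K x)))) \<le> 9 * card A"
      using nnK K fin by (intro sum_card_cball_le) auto
    from card_above_mean_le[OF K(1) this _ cA, of s]
    have b1: "real (card {x\<in>K. real (card (A \<inter> cball x (dist x (nn K x)))) > card A / s}) \<le> 9 * s"
      using s by simp
    \<comment> \<open>Since \<open>g\<close> scales all distances by \<open>cmod l\<close>, it
      carries nearest neighbours in \<open>K\<close> to nearest neighbours in the image of
      \<open>K\<close>.\<close>
    have "(\<Sum>y\<in>g ` K. card (B \<inter> cball y (dist y (g (nn K (inv g y)))))) \<le> 9 * card B"
      using nnK K fin g by (intro sum_card_cball_le) (auto intro!: mult_left_mono, metis)
    then have "(\<Sum>x\<in>K. card (B \<inter> cball (g x) (dist (g x) (g (nn K x))))) \<le> 9 * card B"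
      using g(1) by (subst (asm) sum.reindex) (auto simp: inj_on_def inj_def)
    from card_above_mean_le[OF K(1) this _ cB, of s]
    have b2: "real (card {x\<in>K. real (card (B \<inter> cball (g x) (dist (g x) (g (nn K x))))) > card B / s}) \<le> 9 * s"
      using s by simp
    let ?b1 = "{x\<in>K. real (card (A \<inter> cball x (dist x (nn K x)))) > card A / s}"
    let ?b2 = "{x\<in>K. real (card (B \<inter> cball (g x) (dist (g x) (g (nn K x))))) > card B / s}"
    have "K \<subseteq> ?b1 \<union> ?b2 \<union> good \<kappa>"
    proof
      fix x assume x: "x \<in> K"
      have "nn K x \<in> A" "x \<in> A" "g x \<in> B" "g (nn K x) \<in> B" using nnK(1)[OF x] K x by (auto simp: g_def)
      then show "x \<in> ?b1 \<union> ?b2 \<union> good \<kappa>"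
        using x K(2) by (auto simp: good_def P_def K_def[symmetric, unfolded lc] g_def lc not_less)
    qed
    then have "card K \<le> card (?b1 \<union> ?b2 \<union> good \<kappa>)"
      using K fin by (intro card_mono) (auto simp: good_def)
    also have "\<dots> \<le> card ?b1 + card ?b2 + card (good \<kappa>)"
      by (meson add_mono card_Un_le le_trans order_refl)
    finally have "real (card K) \<le> real (card ?b1) + real (card ?b2) + real (card (good \<kappa>))" by linarith
    then have "real (card K) \<le> 19 * s + card (good \<kappa>)" using b1 b2 s by linarith
    then show ?thesis by (simp add: K_def)
  qed
  have fP: "finite (P S)" if "finite S" for S
    using that by (intro finite_subset[OF _ finite_cartesian_product[of S S]]) (auto simp: P_def)
  have fgood: "finite (good \<kappa>)" for \<kappa> using fin by (auto simp: good_def)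
  define \<phi> where "\<phi> = (\<lambda>(\<kappa>, x). ((x, nn (line_pts A B \<kappa>) x), (fst \<kappa> * x + snd \<kappa>, fst \<kappa> * nn (line_pts A B \<kappa>) x + snd \<kappa>)))"
  \<comment> \<open>A point and its distinct neighbour lie on only one line.\<close>
  have inj: "inj_on \<phi> (Sigma L good)"
  proof (rule inj_onI)
    fix p q assume pq: "p \<in> Sigma L good" "q \<in> Sigma L good" "\<phi> p = \<phi> q"
    obtain l c x where p: "p = ((l, c), x)" by (metis surj_pair)
    obtain l' c' x' where q: "q = ((l', c'), x')" by (metis surj_pair)
    define y where "y = nn (line_pts A B (l, c)) x"
    have yx: "y \<noteq> x" using nn[of "line_pts A B (l, c)" x] pq(1) fin by (auto simp: p good_def y_def)
    have e: "x = x'" "l * x + c = l' * x + c'" "l * y + c = l' * y + c'"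
      using pq(3) by (auto simp: \<phi>_def p q y_def)
    have "(l - l') * (y - x) = ((l * y + c) - (l' * y + c')) - ((l * x + c) - (l' * x + c'))"
      by (simp add: algebra_simps)
    also have "\<dots> = 0" unfolding e(2,3) by simp
    finally have "(l - l') * (y - x) = 0" .
    then have "l = l'" using yx by simp
    then show "p = q" using e p q by simp
  qed
  have "(\<Sum>\<kappa>\<in>L. real (card (good \<kappa>))) = card (Sigma L good)"
    using fin fgood by simp
  also have "card (Sigma L good) \<le> card (P A \<times> P B)"
  proof (rule card_inj_on_le[OF inj])
    show "\<phi> ` Sigma L good \<subseteq> P A \<times> P B" by (auto simp: \<phi>_def good_def)
  qed (use fP fin in auto)
  also have "real (card (P A \<times> P B)) = real (card (P A)) * real (card (P B))" by (simp add: card_cartesian_product)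
  also have "\<dots> \<le> (card A * (card A / s)) * (card B * (card B / s))"
    unfolding P_def using fin s by (intro mult_mono card_close_pairs_le) auto
  also have "\<dots> = (real (card A) * real (card B))\<^sup>2 / s\<^sup>2" by (simp add: power2_eq_square)
  finally have g: "(\<Sum>\<kappa>\<in>L. real (card (good \<kappa>))) \<le> (real (card A) * real (card B))\<^sup>2 / s\<^sup>2" by simp
  have "(\<Sum>\<kappa>\<in>L. real (card (line_pts A B \<kappa>))) \<le> (\<Sum>\<kappa>\<in>L. 19 * s + card (good \<kappa>))"
    by (intro sum_mono each)
  also have "\<dots> = 19 * s * card L + (\<Sum>\<kappa>\<in>L. real (card (good \<kappa>)))"
    by (simp add: sum.distrib)
  finally show ?thesis using g by linarith
qed

text \<open>With \<open>s = t / 38\<close> the linear term of \<open>incidence_bound\<close> is half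
  of \<open>t * card L\<close> and is absorbed. This needs \<open>t \<ge> 38\<close> and yields the
  constant \<open>2888 = 2 * 38^2\<close>.\<close>

lemma rich_lines_bound:
  fixes A B :: "complex set" and t :: real
  assumes fin: "finite A" "finite B" "finite L" and nz: "\<And>l c. (l, c) \<in> L \<Longrightarrow> l \<noteq> 0" and t: "t \<ge> 38"
    and rich: "\<And>\<kappa>. \<kappa> \<in> L \<Longrightarrow> t \<le> card (line_pts A B \<kappa>)"
  shows "card L * t ^ 3 \<le> 2888 * (real (card A) * real (card B))\<^sup>2"
proof -
  let ?G = "(real (card A) * real (card B))\<^sup>2"
  have "t * card L = (\<Sum>\<kappa>\<in>L. t)" by simp
  also have "\<dots> \<le> (\<Sum>\<kappa>\<in>L. real (card (line_pts A B \<kappa>)))" by (intro sum_mono rich)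
  also have "\<dots> \<le> 19 * (t / 38) * card L + ?G / (t / 38)\<^sup>2"
    by (rule incidence_bound[OF fin nz]) (use t in auto)
  finally have "t * card L \<le> 2 * ?G * 1444 / t\<^sup>2" by (simp add: field_simps)
  then have "t * card L * t\<^sup>2 \<le> 2 * ?G * 1444" using t by (simp add: field_simps)
  then show ?thesis by (simp add: power3_eq_cube power2_eq_square mult_ac)
qed

section \<open>Second moments from level-set estimates\<close>

text \<open>Layer-cake summation: a weak-type quadratic bound controls the second moment at the
  price of a harmonic sum.\<close>

lemma sum_squares_le_harm:
  fixes f :: "'a \<Rightarrow> nat" and Z :: real
  assumes "finite S" and N: "\<And>x. x \<in> S \<Longrightarrow> f x \<le> N"
    and weak: "\<And>t. 1 \<le> t \<Longrightarrow> t \<le> N \<Longrightarrow> card {x\<in>S. t \<le> f x} * (real t)\<^sup>2 \<le> Z"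
  shows "(\<Sum>x\<in>S. (real (f x))\<^sup>2) \<le> 2 * Z * harm N"
proof -
  have sq: "(real n)\<^sup>2 \<le> (\<Sum>t=1..n. 2 * real t)" for n
    by (induction n) (auto simp: power2_eq_square algebra_simps)
  have "(\<Sum>x\<in>S. (real (f x))\<^sup>2) \<le> (\<Sum>x\<in>S. \<Sum>t=1..N. if t \<le> f x then 2 * real t else 0)"
  proof (rule sum_mono)
    fix x assume x: "x \<in> S"
    have "(\<Sum>t=1..f x. 2 * real t) = (\<Sum>t\<in>{1..N} \<inter> {t. t \<le> f x}. 2 * real t)"
      using N[OF x] by (intro sum.cong) auto
    also have "\<dots> = (\<Sum>t=1..N. if t \<le> f x then 2 * real t else 0)"
      by (simp add: sum.inter_restrict)
    finally show "(real (f x))\<^sup>2 \<le> (\<Sum>t=1..N. if t \<le> f x then 2 * real t else 0)"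
      using sq[of "f x"] by linarith
  qed
  also have "\<dots> = (\<Sum>t=1..N. \<Sum>x\<in>S. if t \<le> f x then 2 * real t else 0)" by (rule sum.swap)
  also have "\<dots> = (\<Sum>t=1..N. card {x\<in>S. t \<le> f x} * (2 * real t))"
    using assms(1) by (intro sum.cong refl) (simp add: sum.If_cases Int_def)
  also have "\<dots> \<le> (\<Sum>t=1..N. 2 * Z * inverse (real t))"
  proof (rule sum_mono)
    fix t assume t: "t \<in> {1..N}"
    then have "card {x\<in>S. t \<le> f x} * (2 * real t) = 2 * (card {x\<in>S. t \<le> f x} * (real t)\<^sup>2) * inverse (real t)"
      by (simp add: power2_eq_square field_simps)
    also have "\<dots> \<le> 2 * Z * inverse (real t)"
      using weak[of t] t by (intro mult_right_mono) auto
    finally show "card {x\<in>S. t \<le> f x} * (2 * real t) \<le> 2 * Z * inverse (real t)" .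
  qed
  also have "\<dots> = 2 * Z * harm N" by (simp add: harm_def sum_distrib_left)
  finally show ?thesis .
qed

text \<open>For \<open>t \<ge> R\<close> one factor \<open>t\<close> of the cubic bound is at least
  \<open>R\<close>, which leaves a quadratic bound with \<open>Z = M / R\<close>. Levels below
  \<open>R\<close> reduce to the level \<open>R\<close>, because only values of at least
  \<open>R\<close> are summed.\<close>

lemma sum_squares_large_le_harm:
  fixes f :: "'a \<Rightarrow> nat" and R M :: real
  assumes "finite S" and N: "\<And>x. x \<in> S \<Longrightarrow> f x \<le> N" and R: "0 < R"
    and weak: "\<And>t :: real. R \<le> t \<Longrightarrow> card {x\<in>S. t \<le> f x} * t ^ 3 \<le> M"
  shows "(\<Sum>x\<in>{x\<in>S. R \<le> real (f x)}. (real (f x))\<^sup>2) \<le> 2 * (M / R) * harm N"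
proof (rule sum_squares_le_harm)
  fix t :: nat
  have M0: "0 \<le> M" using weak[of R] R by (smt (verit) mult_nonneg_nonneg of_nat_0_le_iff zero_le_power)
  show "card {x \<in> {x\<in>S. R \<le> f x}. t \<le> f x} * (real t)\<^sup>2 \<le> M / R"
  proof (cases "R \<le> t")
    case True
    then have e: "{x \<in> {x\<in>S. R \<le> f x}. t \<le> f x} = {x\<in>S. real t \<le> f x}" by auto
    have "card {x\<in>S. real t \<le> f x} * (real t)\<^sup>2 * R \<le> card {x\<in>S. real t \<le> f x} * (real t)\<^sup>2 * t"
      using True by (intro mult_left_mono) auto
    also have "\<dots> \<le> M" using weak[OF True] by (simp add: power3_eq_cube power2_eq_square mult_ac)
    finally show ?thesis using e R by (simp add: field_simps)
  next
    case False
    have "card {x \<in> {x\<in>S. R \<le> f x}. t \<le> f x} * (real t)\<^sup>2 \<le> card {x\<in>S. R \<le> f x} * R\<^sup>2"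
      using False assms(1) by (intro mult_mono power_mono of_nat_mono card_mono) auto
    also have "\<dots> \<le> M / R" using weak[of R] R by (simp add: field_simps power3_eq_cube power2_eq_square)
    finally show ?thesis .
  qed
qed (use assms in auto)

section \<open>Rich dilations\<close>

text \<open>For fixed \<open>(u, a)\<close> the points \<open>(\<nu>, a - \<nu> * u)\<close> lie on
  a line of slope \<open>- u\<close>, so incidences of \<open>n^2\<close> lines with the grid
  \<open>N \<times> X\<close> are counted. The choice \<open>s = k powr (2/3)\<close> makes both
  terms of \<open>incidence_bound\<close> multiples of \<open>k powr (2/3) * n^2\<close>; cubing
  finishes.\<close>

lemma rich_dilates_bound:
  fixes X N :: "complex set" and t :: real
  assumes fin: "finite X" "finite N" and X0: "0 \<notin> X" and t: "0 < t"
    and rich: "\<And>\<nu>. \<nu> \<in> N \<Longrightarrow> t \<le> card {(u, a). u \<in> X \<and> a \<in> X \<and> a - \<nu> * u \<in> X}"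
  shows "card N * t ^ 3 \<le> 8000 * real (card X) ^ 6"
proof (cases "N = {}")
  case False
  define n where "n = real (card X)"
  define k where "k = real (card N)"
  define L where "L = (\<lambda>(u, a). (- u, a)) ` (X \<times> X)"
  have k1: "k \<ge> 1" using False fin by (simp add: k_def Suc_le_eq card_gt_0_iff)
  have inj: "inj_on (\<lambda>(u, a). (- u, a)) (X \<times> X)" by (auto simp: inj_on_def)
  have cL: "real (card L) = n\<^sup>2" by (simp add: L_def card_image[OF inj] card_cartesian_product n_def power2_eq_square)
  have "k * t = (\<Sum>\<nu>\<in>N. t)" by (simp add: k_def)
  also have "\<dots> \<le> (\<Sum>\<nu>\<in>N. real (card {(u, a). u \<in> X \<and> a \<in> X \<and> a - \<nu> * u \<in> X}))"
    by (intro sum_mono rich)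
  also have "\<dots> = (\<Sum>\<nu>\<in>N. \<Sum>p\<in>X \<times> X. if snd p - \<nu> * fst p \<in> X then 1 else 0)"
    using fin by (intro sum.cong refl)
      (auto simp: sum.If_cases intro!: arg_cong[where f = card])
  also have "\<dots> = (\<Sum>p\<in>X \<times> X. \<Sum>\<nu>\<in>N. if snd p - \<nu> * fst p \<in> X then 1 else 0)" by (rule sum.swap)
  also have "\<dots> = (\<Sum>p\<in>X \<times> X. real (card (line_pts N X (- fst p, snd p))))"
    using fin by (intro sum.cong refl)
      (auto simp: sum.If_cases line_pts_def algebra_simps intro!: arg_cong[where f = card])
  also have "\<dots> = (\<Sum>\<kappa>\<in>L. real (card (line_pts N X \<kappa>)))"
    unfolding L_def by (subst sum.reindex[OF inj]) (auto intro!: sum.cong)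
  also have "\<dots> \<le> 19 * (k powr (2/3)) * card L + (real (card N) * real (card X))\<^sup>2 / (k powr (2/3))\<^sup>2"
    by (rule incidence_bound) (use fin X0 k1 ge_one_powr_ge_zero in \<open>auto simp: L_def\<close>)
  also have "\<dots> = 19 * k powr (2/3) * n\<^sup>2 + (k\<^sup>2 / (k powr (2/3))\<^sup>2) * n\<^sup>2"
    by (simp add: cL k_def n_def power_mult_distrib)
  also have "k\<^sup>2 / (k powr (2/3))\<^sup>2 = k powr (2/3)"
  proof -
    have "k powr (4/3) * k powr (2/3) = k\<^sup>2" using k1 by (simp flip: powr_add)
    then show ?thesis using k1 by (simp add: powr_power field_simps)
  qed
  finally have "k * t \<le> 20 * k powr (2/3) * n\<^sup>2" by (simp add: mult_ac)
  then have "(k * t) ^ 3 \<le> (20 * k powr (2/3) * n\<^sup>2) ^ 3"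
    using k1 t by (intro power_mono) auto
  also have "\<dots> = 8000 * (k powr (2/3)) ^ 3 * n ^ 6" by (simp add: power_mult_distrib flip: power_mult)
  also have "(k powr (2/3)) ^ 3 = k\<^sup>2" using k1 by (simp add: powr_power)
  finally have "k\<^sup>2 * (k * t ^ 3) \<le> k\<^sup>2 * (8000 * n ^ 6)"
    by (simp add: power_mult_distrib power2_eq_square power3_eq_cube mult_ac)
  then show ?thesis using k1 by (simp add: k_def n_def)
qed simp

text \<open>An energy form of the Elekes--Ruzsa argument: a dilation of \<open>Y\<close> by \<open>\<mu>\<close> that overlaps \<open>Y\<close>
  produces many lines of slope \<open>\<mu>\<close> that are simultaneously rich in the grids \<open>D \<times> X\<close> and \<open>X \<times> D\<close>.\<close>

lemma overlapping_dilates_bound: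
  fixes X Y D N :: "complex set" and \<delta> m G H :: real
  assumes fin: "finite X" "finite D" "finite N" and Y: "Y \<subseteq> X" and N0: "0 \<notin> N"
    and deg: "\<And>x. x \<in> Y \<Longrightarrow> \<delta> \<le> card {a\<in>X. x - a \<in> D}" and \<delta>: "0 < \<delta>" and m: "0 < m"
    and over: "\<And>\<mu>. \<mu> \<in> N \<Longrightarrow> m \<le> card {u\<in>Y. \<mu> * u \<in> Y}"
    and G: "G = real (card X) * real (card D)" "0 < G" and big: "152 * G \<le> m * \<delta>\<^sup>2"
    and H: "harm (card X) \<le> H" "harm (card D) \<le> H"
  shows "card N * m\<^sup>2 \<le> 16 * 2888 * G ^ 3 * H / \<delta> ^ 4"
proof -
  \<comment> \<open>With this threshold the lines that are poor in one of the two grids contribute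
    at most \<open>2 * R * (card N * G)\<close>, half of \<open>card N * (m * \<delta>^2)\<close>.
    The hypothesis \<open>big\<close> makes \<open>R\<close> large enough for
    \<open>rich_lines_bound\<close>.\<close>
  define R where "R = m * \<delta>\<^sup>2 / (4 * G)"
  have R: "R \<ge> 38" using big G by (simp add: R_def field_simps)
  define C where "C = (\<lambda>(\<mu>, a, d). (\<mu>, \<mu> * a - d)) ` (N \<times> X \<times> D)"
  have finC: "finite C" using fin by (auto simp: C_def)
  define k where "k = (\<lambda>\<kappa>. card (line_pts D X \<kappa>))"
  define w where "w = (\<lambda>\<kappa>. card (line_pts X D (fst \<kappa>, - snd \<kappa>)))"
  have G0: "0 < card X" "0 < card D" using G by (auto simp: zero_less_mult_iff)
  have finY: "finite Y" using Y fin finite_subset by blast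
  \<comment> \<open>The choices of \<open>a\<close> and \<open>b\<close> are independent, so every
    overlapping \<open>u\<close> carries at least \<open>\<delta>^2\<close> elements.\<close>
  define T where "T = (SIGMA \<mu>:N. SIGMA u:{u\<in>Y. \<mu> * u \<in> Y}. {a\<in>X. u - a \<in> D} \<times> {b\<in>X. \<mu> * u - b \<in> D})"
  have finT: "finite T" using fin finY unfolding T_def by (intro finite_SigmaI) auto
  have "card N * (m * \<delta>\<^sup>2) = (\<Sum>\<mu>\<in>N. m * \<delta>\<^sup>2)" by simp
  also have "\<dots> \<le> (\<Sum>\<mu>\<in>N. \<Sum>u\<in>{u\<in>Y. \<mu> * u \<in> Y}. \<delta>\<^sup>2)"
    using over \<delta> by (intro sum_mono) (auto intro!: mult_right_mono)
  also have "\<dots> \<le> (\<Sum>\<mu>\<in>N. \<Sum>u\<in>{u\<in>Y. \<mu> * u \<in> Y}. real (card ({a\<in>X. u - a \<in> D} \<times> {b\<in>X. \<mu> * u - b \<in> D})))"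
    unfolding card_cartesian_product of_nat_mult power2_eq_square using deg \<delta>
    by (intro sum_mono mult_mono) auto
  also have "\<dots> = card T"
    unfolding T_def using fin finY by simp
  finally have low: "card N * (m * \<delta>\<^sup>2) \<le> card T" .
  have "card T \<le> card (SIGMA \<kappa>:C. line_pts D X \<kappa> \<times> line_pts X D (fst \<kappa>, - snd \<kappa>))"
  proof (rule card_inj_on_le)
    \<comment> \<open>Put \<open>c = \<mu> * a - (\<mu> * u - b)\<close>. The line
      \<open>(\<mu>, c)\<close> sends \<open>u - a\<close> to \<open>b\<close>, and the line
      \<open>(\<mu>, - c)\<close> sends \<open>a\<close> to \<open>\<mu> * u - b\<close>: one
      incidence in each grid. Slope, intercept and the two abscissae recover the quadruple.\<close>
    let ?f = "\<lambda>(\<mu>, u, a, b). ((\<mu>, \<mu> * a - (\<mu> * u - b)), u - a, a)"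
    show "inj_on ?f T" by (auto simp: inj_on_def T_def)
    show "?f ` T \<subseteq> (SIGMA \<kappa>:C. line_pts D X \<kappa> \<times> line_pts X D (fst \<kappa>, - snd \<kappa>))"
    proof
      fix z assume "z \<in> ?f ` T"
      then obtain \<mu> u a b where z: "z = ((\<mu>, \<mu> * a - (\<mu> * u - b)), u - a, a)"
        and h: "\<mu> \<in> N" "a \<in> X" "b \<in> X" "u - a \<in> D" "\<mu> * u - b \<in> D"
        by (auto simp: T_def)
      have "(\<mu>, \<mu> * a - (\<mu> * u - b)) \<in> C"
        unfolding C_def using h by (intro image_eqI[of _ _ "(\<mu>, a, \<mu> * u - b)"]) auto
      moreover have e: "\<mu> * (u - a) + (\<mu> * a - (\<mu> * u - b)) = b" by (simp add: algebra_simps)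
      moreover have "\<mu> * (u - a) + (\<mu> * a - (\<mu> * u - b)) \<in> X" unfolding e by (rule h)
      ultimately show "z \<in> (SIGMA \<kappa>:C. line_pts D X \<kappa> \<times> line_pts X D (fst \<kappa>, - snd \<kappa>))"
        using h unfolding z by (simp add: line_pts_def)
    qed
    show "finite (SIGMA \<kappa>:C. line_pts D X \<kappa> \<times> line_pts X D (fst \<kappa>, - snd \<kappa>))"
      using fin finC by (intro finite_SigmaI) auto
  qed
  also have "\<dots> = (\<Sum>\<kappa>\<in>C. k \<kappa> * w \<kappa>)"
    using fin finC by (simp add: k_def w_def card_cartesian_product)
  finally have "card T \<le> (\<Sum>\<kappa>\<in>C. k \<kappa> * w \<kappa>)" .
  then have "real (card T) \<le> (\<Sum>\<kappa>\<in>C. real (k \<kappa>) * real (w \<kappa>))"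
    by (metis (mono_tags, lifting) of_nat_le_iff of_nat_mult of_nat_sum sum.cong)
  with low have up: "card N * (m * \<delta>\<^sup>2) \<le> (\<Sum>\<kappa>\<in>C. real (k \<kappa>) * real (w \<kappa>))" by linarith
  \<comment> \<open>Lines of the same slope are disjoint, so for each slope every grid point is
    counted at most once; likewise for \<open>w\<close>.\<close>
  have sumk: "(\<Sum>\<kappa>\<in>C. k \<kappa>) \<le> card N * (card X * card D)"
  proof -
    have "(\<Sum>\<kappa>\<in>C. k \<kappa>) = card (SIGMA \<kappa>:C. line_pts D X \<kappa>)" using fin finC by (simp add: k_def)
    also have "\<dots> \<le> card (N \<times> (X \<times> D))"
      by (rule card_inj_on_le[where f = "\<lambda>((\<mu>, c), p). (\<mu>, \<mu> * p + c, p)"])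
        (use fin in \<open>auto simp: inj_on_def C_def line_pts_def\<close>)
    finally show ?thesis by (simp add: card_cartesian_product)
  qed
  have sumw: "(\<Sum>\<kappa>\<in>C. w \<kappa>) \<le> card N * (card X * card D)"
  proof -
    have "(\<Sum>\<kappa>\<in>C. w \<kappa>) = card (SIGMA \<kappa>:C. line_pts X D (fst \<kappa>, - snd \<kappa>))" using fin finC by (simp add: w_def)
    also have "\<dots> \<le> card (N \<times> (X \<times> D))"
      by (rule card_inj_on_le[where f = "\<lambda>((\<mu>, c), p). (\<mu>, p, \<mu> * p - c)"])
        (use fin in \<open>auto simp: inj_on_def C_def line_pts_def, metis minus_diff_eq\<close>)
    finally show ?thesis by (simp add: card_cartesian_product)
  qed
  have G': "real (\<Sum>\<kappa>\<in>C. k \<kappa>) \<le> card N * G" "real (\<Sum>\<kappa>\<in>C. w \<kappa>) \<le> card N * G"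
    using of_nat_mono[OF sumk, where 'a = real] of_nat_mono[OF sumw, where 'a = real] unfolding G(1) by simp_all
  \<comment> \<open>A factor below \<open>R\<close> is replaced by \<open>R\<close>; if both are
    rich, the arithmetic-geometric mean inequality separates them.\<close>
  have pt: "real (k \<kappa>) * real (w \<kappa>) \<le> R * w \<kappa> + R * k \<kappa>
      + ((if R \<le> k \<kappa> then (real (k \<kappa>))\<^sup>2 else 0) + (if R \<le> w \<kappa> then (real (w \<kappa>))\<^sup>2 else 0)) / 2" for \<kappa>
  proof -
    consider "k \<kappa> < R" | "w \<kappa> < R" | "R \<le> k \<kappa>" "R \<le> w \<kappa>" by linarith
    then show ?thesis
    proof cases
      case 1
      then have "real (k \<kappa>) * real (w \<kappa>) \<le> R * w \<kappa>" by (intro mult_right_mono) auto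
      moreover have "0 \<le> R * k \<kappa>" using R by simp
      ultimately show ?thesis by (smt (verit) divide_nonneg_nonneg zero_le_power2)
    next
      case 2
      then have "real (k \<kappa>) * real (w \<kappa>) \<le> R * k \<kappa>" by (subst mult.commute, intro mult_right_mono) auto
      moreover have "0 \<le> R * w \<kappa>" using R by simp
      ultimately show ?thesis by (smt (verit) divide_nonneg_nonneg zero_le_power2)
    next
      case 3
      have "2 * (real (k \<kappa>) * real (w \<kappa>)) \<le> (real (k \<kappa>))\<^sup>2 + (real (w \<kappa>))\<^sup>2"
        using sum_squares_bound[of "real (k \<kappa>)" "real (w \<kappa>)"] by (simp add: mult.assoc)
      moreover have "0 \<le> R * k \<kappa>" "0 \<le> R * w \<kappa>" using R by simp_all
      ultimately show ?thesis unfolding if_P[OF 3(1)] if_P[OF 3(2)] by argo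
    qed
  qed
  have rk: "(\<Sum>\<kappa>\<in>C. if R \<le> k \<kappa> then (real (k \<kappa>))\<^sup>2 else 0) \<le> 2 * (2888 * G\<^sup>2 / R) * H"
  proof -
    have "(\<Sum>\<kappa>\<in>{\<kappa>\<in>C. R \<le> real (k \<kappa>)}. (real (k \<kappa>))\<^sup>2) \<le> 2 * (2888 * G\<^sup>2 / R) * harm (card D)"
    proof (rule sum_squares_large_le_harm)
      fix t :: real assume t: "R \<le> t"
      have "card {\<kappa> \<in> C. t \<le> k \<kappa>} * t ^ 3 \<le> 2888 * (real (card D) * real (card X))\<^sup>2"
        by (rule rich_lines_bound) (use t R fin finC N0 in \<open>auto simp: k_def C_def\<close>)
      then show "card {\<kappa> \<in> C. t \<le> k \<kappa>} * t ^ 3 \<le> 2888 * G\<^sup>2" unfolding G(1) by (simp add: mult.commute)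
    qed (use finC R fin in \<open>auto simp: k_def line_pts_def intro!: card_mono\<close>)
    also have "\<dots> \<le> 2 * (2888 * G\<^sup>2 / R) * H" using R H by (intro mult_left_mono) auto
    finally show ?thesis using finC by (simp add: sum.If_cases Int_def)
  qed
  have rw: "(\<Sum>\<kappa>\<in>C. if R \<le> w \<kappa> then (real (w \<kappa>))\<^sup>2 else 0) \<le> 2 * (2888 * G\<^sup>2 / R) * H"
  proof -
    have "(\<Sum>\<kappa>\<in>{\<kappa>\<in>C. R \<le> real (w \<kappa>)}. (real (w \<kappa>))\<^sup>2) \<le> 2 * (2888 * G\<^sup>2 / R) * harm (card X)"
    proof (rule sum_squares_large_le_harm)
      fix t :: real assume t: "R \<le> t"
      let ?n = "\<lambda>\<kappa> :: complex \<times> complex. (fst \<kappa>, - snd \<kappa>)"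
      have "card (?n ` {\<kappa> \<in> C. t \<le> w \<kappa>}) * t ^ 3 \<le> 2888 * (real (card X) * real (card D))\<^sup>2"
        by (rule rich_lines_bound) (use t R fin finC N0 in \<open>auto simp: w_def C_def\<close>)
      moreover have "card (?n ` {\<kappa> \<in> C. t \<le> w \<kappa>}) = card {\<kappa> \<in> C. t \<le> w \<kappa>}"
        by (rule card_image) (auto simp: inj_on_def prod_eq_iff)
      ultimately show "card {\<kappa> \<in> C. t \<le> w \<kappa>} * t ^ 3 \<le> 2888 * G\<^sup>2" unfolding G(1) by simp
    qed (use finC R fin in \<open>auto simp: w_def line_pts_def intro!: card_mono\<close>)
    also have "\<dots> \<le> 2 * (2888 * G\<^sup>2 / R) * H" using R H by (intro mult_left_mono) auto
    finally show ?thesis using finC by (simp add: sum.If_cases Int_def)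
  qed
  have "card N * (m * \<delta>\<^sup>2) \<le> (\<Sum>\<kappa>\<in>C. R * w \<kappa> + R * k \<kappa>
      + ((if R \<le> k \<kappa> then (real (k \<kappa>))\<^sup>2 else 0) + (if R \<le> w \<kappa> then (real (w \<kappa>))\<^sup>2 else 0)) / 2)"
    using up sum_mono[of C, OF pt] by (rule order_trans)
  also have "\<dots> = R * real (\<Sum>\<kappa>\<in>C. w \<kappa>) + R * real (\<Sum>\<kappa>\<in>C. k \<kappa>)
      + ((\<Sum>\<kappa>\<in>C. if R \<le> k \<kappa> then (real (k \<kappa>))\<^sup>2 else 0) + (\<Sum>\<kappa>\<in>C. if R \<le> w \<kappa> then (real (w \<kappa>))\<^sup>2 else 0)) / 2"
    by (simp only: sum.distrib sum_distrib_left of_nat_sum flip: sum_divide_distrib)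
  also have "\<dots> \<le> R * (card N * G) + R * (card N * G) + (2 * (2888 * G\<^sup>2 / R) * H + 2 * (2888 * G\<^sup>2 / R) * H) / 2"
    using G' R rk rw by (intro add_mono mult_left_mono divide_right_mono) auto
  also have "R * (card N * G) = card N * (m * \<delta>\<^sup>2) / 4" using G(2) by (simp add: R_def)
  finally have "card N * (m * \<delta>\<^sup>2) \<le> 4 * 2888 * G\<^sup>2 * H / R" using R by (simp add: field_simps)
  also have "\<dots> = 16 * 2888 * G ^ 3 * H / (m * \<delta>\<^sup>2)"
    by (simp add: R_def power2_eq_square power3_eq_cube)
  finally have "card N * (m * \<delta>\<^sup>2) * (m * \<delta>\<^sup>2) \<le> 16 * 2888 * G ^ 3 * H"
    using m \<delta> by (simp add: pos_le_divide_eq)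
  then have "card N * m\<^sup>2 * \<delta> ^ 4 \<le> 16 * 2888 * G ^ 3 * H"
    by (simp add: power2_eq_square power4_eq_xxxx mult_ac)
  then show ?thesis using \<delta> by (simp add: pos_le_divide_eq)
qed

section \<open>Regular subsets and popular differences\<close>

text \<open>\<open>X\<close> minimises the product of the \<open>1 + e j X\<close> divided by
  \<open>card X ^ M\<close>. If more than half of \<open>X\<close> had too small a degree at some
  scale, then for one \<open>j\<close> the set \<open>Z j\<close> of such points would have at least
  \<open>card X / (2 * J)\<close> elements. Passing to \<open>Z j\<close> shrinks the
  \<open>j\<close>-th factor by more than \<open>2 * c\<close>, increases no other factor, and
  shrinks the denominator by at most \<open>(2 * J) ^ M\<close>. The value of \<open>c\<close> makes
  this contradict minimality.\<close>

lemma regular_subset: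
  fixes e :: "nat \<Rightarrow> 'a set \<Rightarrow> nat" and deg :: "nat \<Rightarrow> 'a set \<Rightarrow> 'a \<Rightarrow> nat" and J M :: nat
  assumes A: "finite A" "A \<noteq> {}"
    and c: "c = 1 / (2 * (2 * real J) ^ M)" and J: "0 < J"
    and mono: "\<And>j Z X. Z \<subseteq> X \<Longrightarrow> X \<subseteq> A \<Longrightarrow> e j Z \<le> e j X"
    and deg: "\<And>j Z X. Z \<subseteq> X \<Longrightarrow> X \<subseteq> A \<Longrightarrow> e j Z \<le> (\<Sum>x\<in>Z. deg j X x)"
  obtains X Y where "X \<subseteq> A" "X \<noteq> {}" "Y \<subseteq> X" "card X \<le> 2 * card Y"
    "real (card A) ^ M \<le> real (card X) ^ M * (\<Prod>j<J. 1 + real (e j A))"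
    "\<forall>j<J. \<forall>x\<in>Y. 1 \<le> c * e j X \<longrightarrow> c * e j X / card X \<le> deg j X x"
proof -
  define \<Phi> where "\<Phi> = (\<lambda>X. (\<Prod>j<J. 1 + real (e j X)) / real (card X) ^ M)"
  let ?S = "Pow A - {{}}"
  have "finite ?S" "?S \<noteq> {}" using A by auto
  then obtain X where X: "X \<in> ?S" and min: "\<And>Z. Z \<in> ?S \<Longrightarrow> \<Phi> X \<le> \<Phi> Z"
    using ex_min_if_finite[of "\<Phi> ` ?S"] by (auto simp: not_less)
  have XA: "X \<subseteq> A" "X \<noteq> {}" and finX: "finite X" using X A finite_subset by auto
  have cX: "real (card X) > 0" and cA: "real (card A) > 0" using XA A finX by (auto simp: card_gt_0_iff)
  define Y where "Y = {x\<in>X. \<forall>j<J. 1 \<le> c * e j X \<longrightarrow> c * e j X / card X \<le> deg j X x}"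
  \<comment> \<open>Comparison with \<open>A\<close> itself keeps \<open>X\<close> large: the
    numerator of \<open>\<Phi> X\<close> is at least 1.\<close>
  have size: "real (card A) ^ M \<le> real (card X) ^ M * (\<Prod>j<J. 1 + real (e j A))"
  proof -
    have "1 / real (card X) ^ M \<le> \<Phi> X"
      unfolding \<Phi>_def using cX by (intro divide_right_mono prod_ge_1) auto
    also have "\<dots> \<le> \<Phi> A" using A by (intro min) auto
    finally show ?thesis using cX cA by (simp add: \<Phi>_def field_simps)
  qed
  have "card X \<le> 2 * card Y"
  proof (rule ccontr)
    assume neg: "\<not> card X \<le> 2 * card Y"
    define Z where "Z = (\<lambda>j. {x\<in>X. 1 \<le> c * e j X \<and> deg j X x < c * e j X / card X})"
    have "X \<subseteq> Y \<union> (\<Union>j<J. Z j)" by (auto simp: Y_def Z_def not_le)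
    then have "card X \<le> card (Y \<union> (\<Union>j<J. Z j))"
      using finX by (intro card_mono) (auto simp: Y_def Z_def)
    also have "\<dots> \<le> card Y + (\<Sum>j<J. card (Z j))"
      using card_Un_le[of Y "\<Union>j<J. Z j"] card_UN_le[of "{..<J}" Z] by simp
    finally have "card X < 2 * (\<Sum>j<J. card (Z j))" using neg by linarith
    then have "real (card X) < real (2 * (\<Sum>j<J. card (Z j)))" by (simp only: of_nat_less_iff)
    then have 1: "real (card X) < 2 * (\<Sum>j<J. real (card (Z j)))" by simp
    have "\<exists>j<J. real (card X) \<le> 2 * J * card (Z j)"
    proof (rule ccontr)
      assume "\<not> (\<exists>j<J. real (card X) \<le> 2 * J * card (Z j))"
      then have "(\<Sum>j<J. real (card (Z j))) \<le> (\<Sum>j<J. real (card X) / (2 * J))"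
        using J by (intro sum_mono) (auto simp: field_simps not_le less_imp_le)
      then show False using 1 J by simp
    qed
    then obtain j where j: "j < J" "real (card X) \<le> 2 * J * card (Z j)" by blast
    then have Z0: "card (Z j) > 0" using cX by (cases "card (Z j) = 0") auto
    then have Zne: "Z j \<noteq> {}" by auto
    then have ce: "1 \<le> c * e j X" by (auto simp: Z_def)
    have ZX: "Z j \<subseteq> X" by (auto simp: Z_def)
    have finZ: "finite (Z j)" using ZX finX finite_subset by blast
    have "real (e j (Z j)) \<le> (\<Sum>x\<in>Z j. real (deg j X x))"
      using deg[OF ZX XA(1), of j] by (metis of_nat_le_iff of_nat_sum)
    also have "\<dots> \<le> (\<Sum>x\<in>Z j. c * e j X / card X)"
      by (intro sum_mono) (auto simp: Z_def)
    also have "\<dots> = c * e j X * (card (Z j) / card X)" by simp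
    also have "\<dots> \<le> c * e j X * 1"
      using ce card_mono[OF finX ZX] cX by (intro mult_left_mono) auto
    \<comment> \<open>The condition \<open>1 \<le> c * e j X\<close> absorbs the summand 1 of the
      factor.\<close>
    finally have eZ: "1 + real (e j (Z j)) \<le> 2 * (c * e j X)" using ce by linarith
    define K where "K = (\<Prod>i\<in>{..<J} - {j}. 1 + real (e i X))"
    have K0: "K > 0" unfolding K_def by (intro prod_pos) (auto simp: add_pos_nonneg)
    have PX: "(\<Prod>i<J. 1 + real (e i X)) = (1 + real (e j X)) * K"
      unfolding K_def using j by (intro prod.remove) auto
    have "(\<Prod>i<J. 1 + real (e i (Z j))) = (1 + real (e j (Z j))) * (\<Prod>i\<in>{..<J} - {j}. 1 + real (e i (Z j)))"
      using j by (intro prod.remove) auto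
    also have "\<dots> \<le> (1 + real (e j (Z j))) * K"
      unfolding K_def using mono[OF ZX XA(1)] by (intro mult_left_mono prod_mono) auto
    also have "\<dots> \<le> 2 * (c * e j X) * K" using eZ K0 by (intro mult_right_mono) auto
    finally have PZ: "(\<Prod>i<J. 1 + real (e i (Z j))) \<le> 2 * (c * e j X) * K" .
    have "\<Phi> X \<le> \<Phi> (Z j)" using ZX XA Zne by (intro min) auto
    then have "(1 + real (e j X)) * K / real (card X) ^ M \<le> 2 * (c * e j X) * K / real (card (Z j)) ^ M"
      unfolding \<Phi>_def PX by (rule order_trans) (intro divide_right_mono PZ, simp)
    then have "K * ((1 + real (e j X)) * real (card (Z j)) ^ M) \<le> K * (2 * (c * e j X) * real (card X) ^ M)"
      using cX Z0 by (simp add: field_simps)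
    then have "(1 + real (e j X)) * real (card (Z j)) ^ M \<le> 2 * (c * e j X) * real (card X) ^ M"
      by (rule mult_left_le_imp_le) (rule K0)
    also have "\<dots> \<le> 2 * (c * e j X) * (2 * real J * real (card (Z j))) ^ M"
      using j ce by (intro mult_left_mono power_mono) auto
    also have "\<dots> = e j X * real (card (Z j)) ^ M"
      using J by (simp add: c power_mult_distrib)
    finally show False using Z0 by simp
  qed
  moreover have "Y \<subseteq> X" by (auto simp: Y_def)
  moreover have "\<forall>j<J. \<forall>x\<in>Y. 1 \<le> c * e j X \<longrightarrow> c * e j X / card X \<le> deg j X x"
    by (simp add: Y_def)
  ultimately show thesis using that[OF XA _ _ size] by blast
qed

section \<open>Popular differences\<close>

definition diff_rep :: "complex set \<Rightarrow> complex \<Rightarrow> nat" where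
  "diff_rep X d = card {a\<in>X. a - d \<in> X}"

definition popular_pairs :: "real \<Rightarrow> complex set \<Rightarrow> (complex \<times> complex) set" where
  "popular_pairs \<rho> X = {(x, a). x \<in> X \<and> a \<in> X \<and> \<rho> \<le> diff_rep X (x - a)}"

lemma diff_rep_le: "finite X \<Longrightarrow> diff_rep X d \<le> card X"
  unfolding diff_rep_def by (intro card_mono) auto

lemma diff_rep_mono: "finite X \<Longrightarrow> Z \<subseteq> X \<Longrightarrow> diff_rep Z d \<le> diff_rep X d"
  unfolding diff_rep_def by (intro card_mono) auto

lemma popular_pairs_subset: "popular_pairs \<rho> X \<subseteq> X \<times> X"
  by (auto simp: popular_pairs_def)

lemma finite_popular_pairs [simp]: "finite X \<Longrightarrow> finite (popular_pairs \<rho> X)"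
  using popular_pairs_subset by (rule finite_subset) simp

lemma card_popular_pairs_le: "finite X \<Longrightarrow> card (popular_pairs \<rho> X) \<le> card X * card X"
  using card_mono[OF _ popular_pairs_subset] by (simp add: card_cartesian_product)

lemma popular_pairs_mono:
  assumes "finite X" "Z \<subseteq> X"
  shows "popular_pairs \<rho> Z \<subseteq> popular_pairs \<rho> X"
  using assms diff_rep_mono[OF assms] unfolding popular_pairs_def
  by (auto intro: order_trans[OF _ of_nat_mono])

text \<open>Each popular difference comes from at least \<open>\<rho>\<close> pairs, all of them
  popular. Positivity of \<open>\<rho>\<close> confines \<open>D\<close> to differences that do
  occur.\<close>

lemma popular_differences:
  fixes X :: "complex set" and \<rho> :: real
  assumes X: "finite X" and \<rho>: "0 < \<rho>"
  defines "D \<equiv> {d. \<rho> \<le> diff_rep X d}"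
  shows "finite D" "\<rho> * card D \<le> card (popular_pairs \<rho> X)"
proof -
  have "D \<subseteq> (\<lambda>(a, b). a - b) ` (X \<times> X)"
  proof
    fix d assume "d \<in> D"
    then have "0 < diff_rep X d" using \<rho> by (auto simp: D_def)
    then have "{a\<in>X. a - d \<in> X} \<noteq> {}" unfolding diff_rep_def by (metis card.empty less_irrefl)
    then obtain a where "a \<in> X" "a - d \<in> X" by auto
    then show "d \<in> (\<lambda>(a, b). a - b) ` (X \<times> X)" by (intro image_eqI[of _ _ "(a, a - d)"]) auto
  qed
  then show fin: "finite D" using X by (meson finite_SigmaI finite_imageI finite_subset)
  have "\<rho> * card D = (\<Sum>d\<in>D. \<rho>)" by simp
  also have "\<dots> \<le> (\<Sum>d\<in>D. real (card {a\<in>X. a - d \<in> X}))"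
    by (intro sum_mono) (auto simp: D_def diff_rep_def)
  also have "\<dots> = card (SIGMA d:D. {a\<in>X. a - d \<in> X})" using fin X by simp
  also have "card (SIGMA d:D. {a\<in>X. a - d \<in> X}) \<le> card (popular_pairs \<rho> X)"
    by (rule card_inj_on_le[where f = "\<lambda>(d, a). (a, a - d)"])
      (use X finite_popular_pairs[OF X, of \<rho>] in \<open>auto simp: inj_on_def popular_pairs_def D_def\<close>)
  finally show "\<rho> * card D \<le> card (popular_pairs \<rho> X)" by simp
qed

section \<open>Energy at one scale\<close>

text \<open>As \<open>(\<mu> - 1) * u\<close> is the difference of \<open>\<mu> * u\<close> and
  \<open>u\<close>, each member gives a popular pair. The half-open window lets the scales
  \<open>\<rho> = q ^ j\<close> adjoin without overlap.\<close>

definition overlap :: "complex set \<Rightarrow> complex set \<Rightarrow> real \<Rightarrow> real \<Rightarrow> complex \<Rightarrow> complex set" where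
  "overlap X Y \<rho> q \<mu> = {u\<in>Y. \<mu> * u \<in> Y \<and> \<rho> \<le> real (diff_rep X ((\<mu> - 1) * u)) \<and> real (diff_rep X ((\<mu> - 1) * u)) < q * \<rho>}"

text \<open>Let \<open>e\<close> count the popular pairs. If \<open>\<rho> * e\<close> is at most
  \<open>n powr (8/3) / c\<close>, large values of \<open>F\<close> are controlled by
  \<open>rich_dilates_bound\<close> and small ones by the first moment. Otherwise regularity
  supplies the degree \<open>c * e / n\<close> that \<open>overlapping_dilates_bound\<close> needs.
  The two estimates meet at \<open>n powr (13/3)\<close>.\<close>

lemma level_energy_bound:
  fixes X Y \<Lambda> :: "complex set" and n \<rho> q c H :: real
  assumes fin: "finite X" "finite \<Lambda>" and X0: "0 \<notin> X" and Y: "Y \<subseteq> X" and \<Lambda>: "0 \<notin> \<Lambda>" "1 \<notin> \<Lambda>"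
    and n: "card X \<le> n" "1 \<le> n" and \<rho>: "1 \<le> \<rho>" and q: "1 \<le> q" and c: "0 < c" "c \<le> 1"
    and H: "harm (card X * card X) \<le> H" "1 \<le> H"
    and reg: "\<And>x. x \<in> Y \<Longrightarrow> 1 \<le> c * card (popular_pairs \<rho> X) \<Longrightarrow>
      c * card (popular_pairs \<rho> X) / n \<le> card {a\<in>X. \<rho> \<le> diff_rep X (x - a)}"
  shows "(\<Sum>\<mu>\<in>\<Lambda>. (\<Sum>u\<in>overlap X Y \<rho> q \<mu>. real (diff_rep X ((\<mu> - 1) * u)))\<^sup>2)
    \<le> 100000 * q\<^sup>2 * H\<^sup>2 * n powr (13/3) / c ^ 4"
proof -
  define e where "e = real (card (popular_pairs \<rho> X))"
  define M where "M = overlap X Y \<rho> q"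
  define F where "F = (\<lambda>\<mu>. \<Sum>u\<in>M \<mu>. diff_rep X ((\<mu> - 1) * u))"
  have finY: "finite Y" using Y fin finite_subset by blast
  have finM: "finite (M \<mu>)" for \<mu> using finY by (auto simp: M_def overlap_def)
  have e0: "e \<ge> 0" by (simp add: e_def)
  have n13: "n powr (13/3) > 0" using n by simp
  have cardM: "card (M \<mu>) \<le> card X" for \<mu>
    using fin Y by (intro card_mono) (auto simp: M_def overlap_def)
  \<comment> \<open>As \<open>u \<noteq> 0\<close>, the popular pair \<open>(\<mu> * u, u)\<close>
    determines \<open>\<mu>\<close>.\<close>
  have sumM: "(\<Sum>\<mu>\<in>\<Lambda>. real (card (M \<mu>))) \<le> e"
  proof -
    have "(\<Sum>\<mu>\<in>\<Lambda>. real (card (M \<mu>))) = card (Sigma \<Lambda> M)" using fin finM by simp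
    also have "card (Sigma \<Lambda> M) \<le> card (popular_pairs \<rho> X)"
    proof (rule card_inj_on_le[where f = "\<lambda>(\<mu>, u). (\<mu> * u, u)"])
      show "inj_on (\<lambda>(\<mu>, u). (\<mu> * u, u)) (Sigma \<Lambda> M)"
        using X0 Y by (auto simp: inj_on_def M_def overlap_def)
      show "(\<lambda>(\<mu>, u). (\<mu> * u, u)) ` Sigma \<Lambda> M \<subseteq> popular_pairs \<rho> X"
        using Y by (auto simp: popular_pairs_def M_def overlap_def left_diff_distrib)
    qed (use fin in auto)
    finally show ?thesis by (simp add: e_def)
  qed
  have FM: "real (F \<mu>) \<le> q * \<rho> * card (M \<mu>)" for \<mu>
  proof -
    have "real (F \<mu>) \<le> (\<Sum>u\<in>M \<mu>. q * \<rho>)"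
      unfolding F_def of_nat_sum by (intro sum_mono) (auto simp: M_def overlap_def)
    then show ?thesis by (simp add: mult.commute)
  qed
  have "(\<Sum>\<mu>\<in>\<Lambda>. (real (F \<mu>))\<^sup>2) \<le> 100000 * q\<^sup>2 * H\<^sup>2 * n powr (13/3) / c ^ 4"
  proof (cases "\<rho> * e \<le> n powr (8/3) / c")
    case True
    \<comment> \<open>Balances \<open>n ^ 6 / T\<close> for the large values against
      \<open>T * n powr (8/3)\<close> for the small ones.\<close>
    define T where "T = n powr (5/3)"
    have T: "0 < T" using n by (simp add: T_def)
    have FX: "F \<mu> \<le> card {(u, a). u \<in> X \<and> a \<in> X \<and> a - (\<mu> - 1) * u \<in> X}" for \<mu>
    proof -
      have "F \<mu> \<le> (\<Sum>u\<in>X. diff_rep X ((\<mu> - 1) * u))"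
        unfolding F_def using fin Y by (intro sum_mono2) (auto simp: M_def overlap_def)
      also have "\<dots> = card (SIGMA u:X. {a\<in>X. a - (\<mu> - 1) * u \<in> X})"
        using fin by (simp add: diff_rep_def)
      also have "(SIGMA u:X. {a\<in>X. a - (\<mu> - 1) * u \<in> X}) = {(u, a). u \<in> X \<and> a \<in> X \<and> a - (\<mu> - 1) * u \<in> X}"
        by auto
      finally show ?thesis .
    qed
    have "(\<Sum>\<mu>\<in>{\<mu>\<in>\<Lambda>. T \<le> real (F \<mu>)}. (real (F \<mu>))\<^sup>2) \<le> 2 * (8000 * n ^ 6 / T) * harm (card X * card X)"
    proof (rule sum_squares_large_le_harm)
      fix \<mu>
      have "card {(u, a). u \<in> X \<and> a \<in> X \<and> a - (\<mu> - 1) * u \<in> X} \<le> card (X \<times> X)"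
        using fin by (intro card_mono) auto
      then show "F \<mu> \<le> card X * card X" using FX[of \<mu>] by (simp add: card_cartesian_product)
    next
      fix t assume t: "T \<le> t"
      let ?N = "{\<mu> \<in> \<Lambda>. t \<le> real (F \<mu>)}"
      have "card ((\<lambda>\<mu>. \<mu> - 1) ` ?N) * t ^ 3 \<le> 8000 * real (card X) ^ 6"
      proof (rule rich_dilates_bound)
        fix \<nu> assume "\<nu> \<in> (\<lambda>\<mu>. \<mu> - 1) ` ?N"
        then obtain \<mu> where "\<nu> = \<mu> - 1" "t \<le> real (F \<mu>)" by auto
        then show "t \<le> card {(u, a). u \<in> X \<and> a \<in> X \<and> a - \<nu> * u \<in> X}"
          using of_nat_mono[OF FX[of \<mu>], where 'a = real] by simp
      qed (use fin X0 T t in auto)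
      moreover have "card ((\<lambda>\<mu>. \<mu> - 1) ` ?N) = card ?N" by (rule card_image) (auto simp: inj_on_def)
      moreover have "real (card X) ^ 6 \<le> n ^ 6" using n by (intro power_mono) auto
      ultimately show "card ?N * t ^ 3 \<le> 8000 * n ^ 6" by simp
    qed (use fin T in auto)
    also have "8000 * n ^ 6 / T = 8000 * n powr (13/3)"
    proof -
      have "n powr (13/3) * T = n ^ 6" using n by (simp add: T_def flip: powr_add)
      then show ?thesis using T by (simp add: field_simps)
    qed
    finally have big: "(\<Sum>\<mu>\<in>{\<mu>\<in>\<Lambda>. T \<le> real (F \<mu>)}. (real (F \<mu>))\<^sup>2) \<le> 16000 * n powr (13/3) * harm (card X * card X)"
      by simp
    also have "\<dots> \<le> 16000 * n powr (13/3) * H" using H by (intro mult_left_mono) auto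
    finally have big: "(\<Sum>\<mu>\<in>{\<mu>\<in>\<Lambda>. T \<le> real (F \<mu>)}. (real (F \<mu>))\<^sup>2) \<le> 16000 * n powr (13/3) * H" .
    have "(\<Sum>\<mu>\<in>{\<mu>\<in>\<Lambda>. \<not> T \<le> real (F \<mu>)}. (real (F \<mu>))\<^sup>2) \<le> (\<Sum>\<mu>\<in>{\<mu>\<in>\<Lambda>. \<not> T \<le> real (F \<mu>)}. T * real (F \<mu>))"
      unfolding power2_eq_square by (intro sum_mono mult_right_mono) auto
    also have "\<dots> \<le> (\<Sum>\<mu>\<in>\<Lambda>. T * real (F \<mu>))" using fin T by (intro sum_mono2) auto
    also have "\<dots> \<le> (\<Sum>\<mu>\<in>\<Lambda>. T * (q * \<rho> * card (M \<mu>)))" using T FM by (intro sum_mono mult_left_mono) auto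
    also have "\<dots> = T * (q * \<rho>) * (\<Sum>\<mu>\<in>\<Lambda>. real (card (M \<mu>)))" by (simp add: sum_distrib_left mult_ac)
    also have "\<dots> \<le> T * (q * \<rho>) * e" using sumM T q \<rho> by (intro mult_left_mono) auto
    also have "\<dots> = T * q * (\<rho> * e)" by simp
    also have "\<dots> \<le> T * q * (n powr (8/3) / c)" using True T q by (intro mult_left_mono) auto
    also have "\<dots> = q * (T * n powr (8/3)) / c" by simp
    also have "T * n powr (8/3) = n powr (13/3)" by (simp add: T_def flip: powr_add)
    finally have small: "(\<Sum>\<mu>\<in>{\<mu>\<in>\<Lambda>. \<not> T \<le> real (F \<mu>)}. (real (F \<mu>))\<^sup>2) \<le> q * n powr (13/3) / c" .
    have "(\<Sum>\<mu>\<in>\<Lambda>. (real (F \<mu>))\<^sup>2) = (\<Sum>\<mu>\<in>{\<mu>\<in>\<Lambda>. T \<le> real (F \<mu>)}. (real (F \<mu>))\<^sup>2) + (\<Sum>\<mu>\<in>{\<mu>\<in>\<Lambda>. \<not> T \<le> real (F \<mu>)}. (real (F \<mu>))\<^sup>2)"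
      using fin by (subst sum.union_disjoint[symmetric]) (auto intro!: sum.cong)
    also have "\<dots> \<le> 16000 * n powr (13/3) * H + q * n powr (13/3) / c"
      using big small by linarith
    also have "\<dots> = n powr (13/3) * (16000 * H + q / c)" by (simp add: algebra_simps)
    also have "\<dots> \<le> n powr (13/3) * (100000 * (q\<^sup>2 * H\<^sup>2 / c ^ 4))"
    proof (intro mult_left_mono)
      have q2: "q \<le> q\<^sup>2" "1 \<le> q\<^sup>2" and H2: "H \<le> H\<^sup>2" "1 \<le> H\<^sup>2"
        using q H by (auto simp: power2_eq_square) (metis mult_mono' mult_1 zero_le_one)+
      have c4: "1 / c \<le> 1 / c ^ 4" "1 \<le> 1 / c ^ 4"
        using c power_decreasing[of 1 4 c] by (auto simp: field_simps power_le_one)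
      have "1 * H * 1 \<le> q\<^sup>2 * H\<^sup>2 * (1 / c ^ 4)" using q2 H2 c4 H by (intro mult_mono) auto
      moreover have "q * 1 * (1 / c) \<le> q\<^sup>2 * H\<^sup>2 * (1 / c ^ 4)" using q2 H2 c4 H q c by (intro mult_mono) auto
      moreover have "0 \<le> q\<^sup>2 * H\<^sup>2 * (1 / c ^ 4)" using c by simp
      ultimately have "16000 * (1 * H * 1) + q * 1 * (1 / c) \<le> 100000 * (q\<^sup>2 * H\<^sup>2 * (1 / c ^ 4))" by linarith
      then show "16000 * H + q / c \<le> 100000 * (q\<^sup>2 * H\<^sup>2 / c ^ 4)" by simp
    qed (use n13 in auto)
    finally show ?thesis by (simp add: mult_ac)
  next
    case False
    define D where "D = {d. \<rho> \<le> diff_rep X d}"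
    have D: "finite D" "\<rho> * card D \<le> e"
      using popular_differences[OF fin(1), of \<rho>] \<rho> by (auto simp: D_def e_def)
    have npos: "0 < n powr (8/3) / c" using n c by simp
    then have "\<rho> * e > 0" using False by linarith
    then have epos: "0 < e" using \<rho> by (simp add: zero_less_mult_iff)
    then have ne: "popular_pairs \<rho> X \<noteq> {}" by (auto simp: e_def)
    then obtain x a where xa: "x \<in> X" "a \<in> X" "\<rho> \<le> diff_rep X (x - a)" by (auto simp: popular_pairs_def)
    have \<rho>n: "\<rho> \<le> n" using xa(3) of_nat_mono[OF diff_rep_le[OF fin(1), of "x - a"], where 'a = real] n by linarith
    have Dne: "0 < card D" using xa D(1) by (auto simp: card_gt_0_iff D_def)
    have Xne: "0 < card X" using xa fin by (auto simp: card_gt_0_iff)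
    \<comment> \<open>This activates the hypothesis \<open>reg\<close>; it follows from the case
      assumption and \<open>\<rho> \<le> n\<close>.\<close>
    have ce: "1 \<le> c * e"
    proof -
      have "n powr 1 \<le> n powr (8/3)" using n by (intro powr_mono) auto
      then have "n \<le> n powr (8/3)" using n by simp
      also have "\<dots> \<le> c * (\<rho> * e)" using False c by (simp add: field_simps)
      also have "\<dots> \<le> c * (n * e)" using \<rho>n c e0 by (intro mult_left_mono mult_right_mono) auto
      finally show ?thesis using n by (simp add: mult_ac)
    qed
    define \<delta> where "\<delta> = c * e / n"
    have \<delta>: "0 < \<delta>" using c epos n by (simp add: \<delta>_def)
    define G where "G = real (card X) * real (card D)"
    have G: "0 < G" using Dne Xne by (simp add: G_def)
    have Gle: "G \<le> n * (e / \<rho>)"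
      unfolding G_def using n D \<rho> by (intro mult_mono) (auto simp: field_simps)
    \<comment> \<open>The smallest \<open>m\<close> allowed by the hypothesis \<open>big\<close> of
      \<open>overlapping_dilates_bound\<close>. Overlaps smaller than \<open>m0\<close> are handled
      by the first moment \<open>sumM\<close>.\<close>
    define m0 where "m0 = 152 * G / \<delta>\<^sup>2"
    have m0: "0 < m0" using G \<delta> by (simp add: m0_def)
    define Z where "Z = 16 * 2888 * G ^ 3 * H / \<delta> ^ 4"
    have Z0: "0 \<le> Z" using G \<delta> H by (simp add: Z_def)
    have harmX: "harm (card X) \<le> H"
    proof -
      have "harm (card X) \<le> (harm (card X * card X) :: real)" using Xne by (intro harm_mono) auto
      then show ?thesis using H by linarith
    qed
    have harmD: "harm (card D) \<le> H"
    proof -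
      have "1 * real (card D) \<le> \<rho> * real (card D)" using \<rho> by (intro mult_right_mono) auto
      then have "card D \<le> card (popular_pairs \<rho> X)" using D(2) unfolding e_def by linarith
      also have "\<dots> \<le> card X * card X" by (rule card_popular_pairs_le[OF fin(1)])
      finally have "harm (card D) \<le> (harm (card X * card X) :: real)" by (intro harm_mono)
      then show ?thesis using H by linarith
    qed
    have weak: "card {\<mu>\<in>\<Lambda>. t \<le> card (M \<mu>)} * t\<^sup>2 \<le> Z" if t: "m0 \<le> t" for t :: real
      unfolding Z_def
    proof (rule overlapping_dilates_bound[where X = X and Y = Y and D = D])
      fix x assume "x \<in> Y"
      then show "\<delta> \<le> card {a\<in>X. x - a \<in> D}"
        using reg[of x] ce by (simp add: \<delta>_def e_def D_def)
    next
      fix \<mu> assume "\<mu> \<in> {\<mu>\<in>\<Lambda>. t \<le> card (M \<mu>)}"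
      then have "t \<le> card (M \<mu>)" by simp
      also have "card (M \<mu>) \<le> card {u\<in>Y. \<mu> * u \<in> Y}"
        using finY by (intro card_mono) (auto simp: M_def overlap_def)
      finally show "t \<le> card {u\<in>Y. \<mu> * u \<in> Y}" by simp
    next
      show "152 * G \<le> t * \<delta>\<^sup>2" using t \<delta> by (simp add: m0_def field_simps)
    qed (use fin D Y \<Lambda> \<delta> m0 t G harmX harmD in \<open>auto simp: G_def\<close>)
    let ?S = "{\<mu>\<in>\<Lambda>. m0 \<le> card (M \<mu>)}"
    have "(\<Sum>\<mu>\<in>?S. (real (card (M \<mu>)))\<^sup>2) \<le> 2 * Z * harm (card X)"
    proof (rule sum_squares_le_harm)
      fix t :: nat
      show "card {\<mu>\<in>?S. t \<le> card (M \<mu>)} * (real t)\<^sup>2 \<le> Z"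
      proof (cases "m0 \<le> t")
        case True
        then have "{\<mu>\<in>?S. t \<le> card (M \<mu>)} = {\<mu>\<in>\<Lambda>. real t \<le> card (M \<mu>)}" by auto
        then show ?thesis using weak[OF True] by simp
      next
        case False
        have "card {\<mu>\<in>?S. t \<le> card (M \<mu>)} * (real t)\<^sup>2 \<le> card ?S * m0\<^sup>2"
          using False fin by (intro mult_mono power_mono of_nat_mono card_mono) auto
        also have "\<dots> \<le> Z" using weak[of m0] by simp
        finally show ?thesis .
      qed
    qed (use fin cardM in auto)
    also have "\<dots> \<le> 2 * Z * H" using Z0 harmX by (intro mult_left_mono) auto
    finally have big: "(\<Sum>\<mu>\<in>?S. (real (card (M \<mu>)))\<^sup>2) \<le> 2 * Z * H" .
    have "(\<Sum>\<mu>\<in>\<Lambda> - ?S. (real (card (M \<mu>)))\<^sup>2) \<le> (\<Sum>\<mu>\<in>\<Lambda> - ?S. m0 * real (card (M \<mu>)))"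
      unfolding power2_eq_square by (intro sum_mono mult_right_mono) auto
    also have "\<dots> \<le> (\<Sum>\<mu>\<in>\<Lambda>. m0 * real (card (M \<mu>)))" using fin m0 by (intro sum_mono2) auto
    also have "\<dots> \<le> m0 * e" using sumM m0 by (simp flip: sum_distrib_left)
    finally have small: "(\<Sum>\<mu>\<in>\<Lambda> - ?S. (real (card (M \<mu>)))\<^sup>2) \<le> m0 * e" .
    have "(\<Sum>\<mu>\<in>\<Lambda>. (real (card (M \<mu>)))\<^sup>2) = (\<Sum>\<mu>\<in>\<Lambda> - ?S. (real (card (M \<mu>)))\<^sup>2) + (\<Sum>\<mu>\<in>?S. (real (card (M \<mu>)))\<^sup>2)"
      using fin by (intro sum.subset_diff) auto
    then have mm: "(\<Sum>\<mu>\<in>\<Lambda>. (real (card (M \<mu>)))\<^sup>2) \<le> m0 * e + 2 * Z * H" using big small by linarith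
    have m0e: "\<rho>\<^sup>2 * (m0 * e) \<le> 152 * n powr (13/3) / c ^ 4"
    proof -
      have "m0 * e \<le> 152 * (n * (e / \<rho>)) / \<delta>\<^sup>2 * e"
        unfolding m0_def using Gle e0 by (intro mult_right_mono divide_right_mono mult_left_mono) auto
      then have "\<rho>\<^sup>2 * (m0 * e) \<le> \<rho>\<^sup>2 * (152 * (n * (e / \<rho>)) / \<delta>\<^sup>2 * e)" by (intro mult_left_mono) auto
      also have "\<dots> = 152 * n ^ 3 * \<rho> / c\<^sup>2"
        using \<rho> epos c n by (simp add: \<delta>_def field_simps power2_eq_square power3_eq_cube)
      also have "\<dots> \<le> 152 * n ^ 3 * n / c\<^sup>2" using \<rho>n n by (intro divide_right_mono mult_left_mono) auto
      also have "\<dots> = 152 * (n ^ 4 / c\<^sup>2)" by (simp add: power3_eq_cube power4_eq_xxxx)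
      also have "n ^ 4 / c\<^sup>2 \<le> n powr (13/3) / c ^ 4"
      proof (intro frac_le)
        have "n powr 4 \<le> n powr (13/3)" using n by (intro powr_mono) auto
        then show "n ^ 4 \<le> n powr (13/3)" using n by simp
        show "c ^ 4 \<le> c\<^sup>2" using c by (intro power_decreasing) auto
      qed (use n c in auto)
      finally show ?thesis by simp
    qed
    \<comment> \<open>Inserting \<open>G \<le> n * (e / \<rho>)\<close> and
      \<open>\<delta> = c * e / n\<close> bounds \<open>\<rho>^2 * Z\<close> by a multiple of
      \<open>H * n ^ 7 / (c ^ 4 * (\<rho> * e))\<close>, and in this case \<open>\<rho> * e\<close>
      exceeds \<open>n powr (8/3)\<close>.\<close>
    have ZH: "\<rho>\<^sup>2 * (2 * Z * H) \<le> 92416 * H\<^sup>2 * n powr (13/3) / c ^ 4"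
    proof -
      have "Z \<le> 16 * 2888 * (n * (e / \<rho>)) ^ 3 * H / \<delta> ^ 4"
        unfolding Z_def using Gle G H by (intro divide_right_mono mult_right_mono mult_left_mono power_mono) auto
      then have "\<rho>\<^sup>2 * (2 * Z * H) \<le> \<rho>\<^sup>2 * (2 * (16 * 2888 * (n * (e / \<rho>)) ^ 3 * H / \<delta> ^ 4) * H)"
        using H by (intro mult_left_mono mult_right_mono) auto
      also have "\<dots> = 92416 * H\<^sup>2 * (n ^ 7 / (c ^ 4 * (\<rho> * e)))"
        using \<rho> epos c n by (simp add: \<delta>_def field_simps eval_nat_numeral)
      also have "n ^ 7 / (c ^ 4 * (\<rho> * e)) \<le> n ^ 7 / (c ^ 4 * n powr (8/3))"
      proof (intro divide_left_mono mult_left_mono)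
        have "n powr (8/3) \<le> n powr (8/3) / c" using n c by (simp add: field_simps mult_left_le_one_le)
        then show "n powr (8/3) \<le> \<rho> * e" using False by linarith
      qed (use \<open>\<rho> * e > 0\<close> c n in auto)
      also have "n ^ 7 / (c ^ 4 * n powr (8/3)) = (n ^ 7 / n powr (8/3)) / c ^ 4" by simp
      also have "n ^ 7 / n powr (8/3) = n powr (13/3)"
      proof -
        have "n powr (13/3) * n powr (8/3) = n ^ 7" using n by (simp flip: powr_add)
        then show ?thesis using n by (simp add: field_simps)
      qed
      finally show ?thesis using H by simp
    qed
    have "(\<Sum>\<mu>\<in>\<Lambda>. (real (F \<mu>))\<^sup>2) \<le> (\<Sum>\<mu>\<in>\<Lambda>. (q * \<rho> * card (M \<mu>))\<^sup>2)"
      using FM by (intro sum_mono power_mono) auto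
    also have "\<dots> = q\<^sup>2 * (\<rho>\<^sup>2 * (\<Sum>\<mu>\<in>\<Lambda>. (real (card (M \<mu>)))\<^sup>2))"
      by (simp add: power_mult_distrib sum_distrib_left mult_ac)
    also have "\<dots> \<le> q\<^sup>2 * (\<rho>\<^sup>2 * (m0 * e + 2 * Z * H))" using mm by (intro mult_left_mono) auto
    also have "\<dots> = q\<^sup>2 * (\<rho>\<^sup>2 * (m0 * e) + \<rho>\<^sup>2 * (2 * Z * H))" by (simp add: algebra_simps)
    also have "\<dots> \<le> q\<^sup>2 * (152 * n powr (13/3) / c ^ 4 + 92416 * H\<^sup>2 * n powr (13/3) / c ^ 4)"
      using m0e ZH by (intro mult_left_mono add_mono) auto
    also have "\<dots> = q\<^sup>2 * ((152 + 92416 * H\<^sup>2) * (n powr (13/3) / c ^ 4))" by (simp add: algebra_simps add_divide_distrib)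
    also have "\<dots> \<le> q\<^sup>2 * ((100000 * H\<^sup>2) * (n powr (13/3) / c ^ 4))"
    proof (intro mult_left_mono mult_right_mono)
      have "1 \<le> H\<^sup>2" using H by (simp add: one_le_power)
      then show "152 + 92416 * H\<^sup>2 \<le> 100000 * H\<^sup>2" by simp
    qed (use n13 c in auto)
    finally show ?thesis by (simp add: mult_ac)
  qed
  then show ?thesis by (simp add: F_def M_def)
qed

section \<open>Energy of the product map\<close>

text \<open>Cauchy-Schwarz over the fibres of \<open>f\<close>; the last factor counts
  collisions.\<close>

lemma card_image_energy:
  assumes "finite Q"
  shows "(real (card Q))\<^sup>2 \<le> real (card (f ` Q)) * real (card {(p, q). p \<in> Q \<and> q \<in> Q \<and> f p = f q})"
proof -
  let ?B = "\<lambda>s. {p\<in>Q. f p = s}"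
  have "real (card Q) = (\<Sum>s\<in>f ` Q. real (card (?B s)))"
    using sum.image_gen[OF assms, of "\<lambda>_. 1 :: nat" f] by (simp flip: of_nat_sum)
  then have "(real (card Q))\<^sup>2 \<le> (\<Sum>s\<in>f ` Q. (real (card (?B s)))\<^sup>2) * card (f ` Q)"
    using sum_squared_le_sum_of_squares[of "\<lambda>s. real (card (?B s))" "f ` Q"] by simp
  also have "(\<Sum>s\<in>f ` Q. (real (card (?B s)))\<^sup>2) = real (card (SIGMA s:f ` Q. ?B s \<times> ?B s))"
    using assms by (simp add: card_cartesian_product power2_eq_square)
  also have "card (SIGMA s:f ` Q. ?B s \<times> ?B s) = card {(p, q). p \<in> Q \<and> q \<in> Q \<and> f p = f q}"
    by (rule bij_betw_same_card[of snd], rule bij_betwI[where g = "\<lambda>(p, q). (f p, p, q)"]) auto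
  finally show ?thesis by (simp add: mult.commute)
qed

text \<open>The coordinates of \<open>[x,y,0][x',y',0]\<close>. The set \<open>Y\<close> holds the
  two entries \<open>x\<close> and \<open>y'\<close> that are multiplied, \<open>X\<close> the two
  that are only added.\<close>

definition heis_prod_triples :: "complex set \<Rightarrow> complex set \<Rightarrow> (complex \<times> complex \<times> complex) set" where
  "heis_prod_triples X Y = (\<lambda>(x, x', y, y'). (x + x', y + y', x * y')) ` (Y \<times> X \<times> X \<times> Y)"

definition dilate_weight :: "complex set \<Rightarrow> complex set \<Rightarrow> complex \<Rightarrow> nat" where
  "dilate_weight X Y \<mu> = (\<Sum>u\<in>{u\<in>Y. \<mu> * u \<in> Y}. diff_rep X ((\<mu> - 1) * u))"

definition ratios :: "complex set \<Rightarrow> complex set" where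
  "ratios Y = (\<lambda>(x, u). x / u) ` (Y \<times> Y)"

text \<open>In a collision of \<open>(x, x', y, y')\<close> with \<open>(u, u', v, v')\<close> put
  \<open>\<mu> = x / u\<close>. Then \<open>x = \<mu> * u\<close> and
  \<open>v' = \<mu> * y'\<close>, while \<open>u' - x' = (\<mu> - 1) * u\<close> and
  \<open>y - v = (\<mu> - 1) * y'\<close>. So a collision is a ratio \<open>\<mu>\<close> with two
  elements \<open>(u, u')\<close> and \<open>(y', y)\<close> of the same set \<open>W \<mu>\<close>,
  whose size is the weight of \<open>\<mu>\<close>; this gives the square.\<close>

lemma heis_prod_triples_energy:
  fixes X Y :: "complex set"
  assumes X: "finite X" "0 \<notin> X" and Y: "Y \<subseteq> X"
  shows "(real (card X) * real (card Y)) ^ 4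
    \<le> real (card (heis_prod_triples X Y)) * (\<Sum>\<mu>\<in>ratios Y. (real (dilate_weight X Y \<mu>))\<^sup>2)"
proof -
  have finY: "finite Y" and Y0: "0 \<notin> Y" using X Y finite_subset by auto
  let ?Q = "Y \<times> X \<times> X \<times> Y"
  let ?f = "\<lambda>(x, x', y, y'). (x + x', y + y', x * y') :: complex \<times> complex \<times> complex"
  define W where "W = (\<lambda>\<mu>. SIGMA u:{u\<in>Y. \<mu> * u \<in> Y}. {a\<in>X. a - (\<mu> - 1) * u \<in> X})"
  have finW: "finite (W \<mu>)" for \<mu> unfolding W_def using X finY by (intro finite_SigmaI) auto
  have cardW: "card (W \<mu>) = dilate_weight X Y \<mu>" for \<mu>
    using X finY by (simp add: W_def dilate_weight_def diff_rep_def)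
  have finR: "finite (ratios Y)" using finY by (simp add: ratios_def)
  let ?E = "{(p, q). p \<in> ?Q \<and> q \<in> ?Q \<and> ?f p = ?f q}"
  let ?g = "\<lambda>((x, x', y, y'), (u, u', v, v')). (x / u, (u, u'), (y', y)) :: complex \<times> (complex \<times> complex) \<times> (complex \<times> complex)"
  have elim: "u \<noteq> 0 \<and> x = x / u * u \<and> x' = u' - (x / u - 1) * u \<and> v' = x / u * y' \<and> v = y - (x / u - 1) * y'"
    if h: "u \<in> Y" "x + x' = u + u'" "y + y' = v + v'" "x * y' = u * v'" for x x' y y' u u' v v' :: complex
  proof -
    have u: "u \<noteq> 0" using h Y0 by auto
    have x: "x / u * u = x" using u by simp
    have v': "v' = x / u * y'" using h(4) u by (simp add: field_simps)
    have "x' = u' - (x / u - 1) * u" using h(2) x by (simp add: left_diff_distrib algebra_simps)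
    moreover have "v = y - (x / u - 1) * y'" using h(3) v' by (simp add: left_diff_distrib algebra_simps)
    ultimately show ?thesis using u x v' by simp
  qed
  have "card ?E \<le> card (SIGMA \<mu>:ratios Y. W \<mu> \<times> W \<mu>)"
  proof (rule card_inj_on_le[where f = ?g])
    show "inj_on ?g ?E"
    proof (rule inj_onI)
      fix a b assume ab: "a \<in> ?E" "b \<in> ?E" "?g a = ?g b"
      obtain x x' y y' u u' v v' where a: "a = ((x, x', y, y'), (u, u', v, v'))" by (metis prod.exhaust)
      obtain p p' q q' r r' s s' where b: "b = ((p, p', q, q'), (r, r', s, s'))" by (metis prod.exhaust)
      have e: "x / u = p / r" "u = r" "u' = r'" "y' = q'" "y = q" using ab(3) by (auto simp: a b)
      define \<mu> where "\<mu> = x / u"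
      have \<mu>': "p / r = \<mu>" using e(1) by (simp only: \<mu>_def)
      have "u \<in> Y" "x + x' = u + u'" "y + y' = v + v'" "x * y' = u * v'" using ab(1) by (auto simp: a)
      from elim[OF this, folded \<mu>_def]
      have 1: "x = \<mu> * u" "x' = u' - (\<mu> - 1) * u" "v' = \<mu> * y'" "v = y - (\<mu> - 1) * y'" by blast+
      have "r \<in> Y" "p + p' = r + r'" "q + q' = s + s'" "p * q' = r * s'" using ab(2) by (auto simp: b)
      from elim[OF this, unfolded \<mu>']
      have 2: "p = \<mu> * r" "p' = r' - (\<mu> - 1) * r" "s' = \<mu> * q'" "s = q - (\<mu> - 1) * q'" by blast+
      show "a = b" unfolding a b 1 2 e(2-5) by (rule refl)
    qed
    show "?g ` ?E \<subseteq> (SIGMA \<mu>:ratios Y. W \<mu> \<times> W \<mu>)"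
    proof
      fix z assume "z \<in> ?g ` ?E"
      then obtain a where a: "z = ?g a" "a \<in> ?E" by (rule imageE)
      obtain x x' y y' u u' v v' where a': "a = ((x, x', y, y'), (u, u', v, v'))" by (metis prod.exhaust)
      have z: "z = (x / u, (u, u'), (y', y))" using a(1) by (simp add: a')
      have h: "x \<in> Y" "x' \<in> X" "y \<in> X" "y' \<in> Y" "u \<in> Y" "u' \<in> X" "v \<in> X" "v' \<in> Y"
          "x + x' = u + u'" "y + y' = v + v'" "x * y' = u * v'" using a(2) by (simp_all add: a')
      have k: "x = x / u * u" "x' = u' - (x / u - 1) * u" "v' = x / u * y'" "v = y - (x / u - 1) * y'"
        using elim[OF h(5,9,10,11)] by blast+
      have "x / u \<in> ratios Y" using h by (auto simp: ratios_def)
      moreover have "x / u * u \<in> Y" "u' - (x / u - 1) * u \<in> X" "x / u * y' \<in> Y" "y - (x / u - 1) * y' \<in> X"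
        using h k by metis+
      ultimately show "z \<in> (SIGMA \<mu>:ratios Y. W \<mu> \<times> W \<mu>)"
        unfolding z W_def using h by (intro SigmaI) auto
    qed
    show "finite (SIGMA \<mu>:ratios Y. W \<mu> \<times> W \<mu>)" using finR finW by (intro finite_SigmaI) auto
  qed
  also have "\<dots> = (\<Sum>\<mu>\<in>ratios Y. (dilate_weight X Y \<mu>)\<^sup>2)"
    using finR finW by (simp add: card_cartesian_product cardW power2_eq_square)
  finally have E: "real (card ?E) \<le> (\<Sum>\<mu>\<in>ratios Y. (real (dilate_weight X Y \<mu>))\<^sup>2)"
    by (metis (mono_tags, lifting) of_nat_le_iff of_nat_power of_nat_sum sum.cong)
  have "(real (card X) * real (card Y)) ^ 4 = (real (card ?Q))\<^sup>2"
    by (simp add: card_cartesian_product power2_eq_square power4_eq_xxxx mult_ac)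
  also have "\<dots> \<le> real (card (?f ` ?Q)) * real (card ?E)"
    by (rule card_image_energy) (use X finY in auto)
  also have "\<dots> \<le> real (card (?f ` ?Q)) * (\<Sum>\<mu>\<in>ratios Y. (real (dilate_weight X Y \<mu>))\<^sup>2)"
    using E by (intro mult_left_mono) auto
  finally show ?thesis by (simp add: heis_prod_triples_def)
qed

section \<open>Summation over the scales\<close>

lemma geometric_level:
  fixes q r :: real
  assumes "1 \<le> r" "r < q ^ J"
  shows "\<exists>j<J. q ^ j \<le> r \<and> r < q * q ^ j"
  using assms
proof (induction J)
  case (Suc J)
  then show ?case by (cases "r < q ^ J") (auto simp: less_Suc_eq)
qed simp

text \<open>From \<open>harm N \<le> 1 + ln N\<close> and
  \<open>ln x \<le> 400 * x powr (1/400)\<close>: the logarithm is traded for a power small enough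
  for the slack in the final exponent.\<close>

lemma harm_square_le:
  fixes n :: nat and x :: real
  assumes "1 \<le> n" "real n \<le> x"
  shows "harm (n * n) \<le> 801 * x powr (1/400)"
proof -
  obtain k where k: "n * n = Suc k" using assms(1) by (metis One_nat_def Suc_le_D mult_Suc add_Suc)
  have "harm (Suc k) - ln (real (Suc k)) \<le> harm (Suc 0) - ln (real (Suc 0))"
    using decseqD[OF decseq_harm_diff_ln, of 0 k] by simp
  then have "harm (n * n) \<le> 1 + ln (real (n * n))" unfolding k by (simp add: harm_def)
  also have "ln (real (n * n)) = 2 * ln (real n)" using assms by (simp add: ln_mult)
  also have "ln (real n) \<le> ln x" using assms by simp
  also have "ln x \<le> x powr (1/400) / (1/400)" using assms by (intro ln_powr_bound) auto
  finally have "harm (n * n) \<le> 1 + 800 * x powr (1/400)" by simp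
  moreover have "1 \<le> x powr (1/400)" using assms by (intro ge_one_powr_ge_zero) auto
  ultimately show ?thesis by linarith
qed

text \<open>The representation numbers in the weight lie between 1 and \<open>n\<close>, so the
  \<open>J\<close> windows cover them. Cauchy-Schwarz over the scales costs one factor
  \<open>J\<close>, adding up the level bounds the other.\<close>

lemma dilate_energy_bound:
  fixes X Y :: "complex set" and n q c H :: real
  assumes fin: "finite X" and X0: "0 \<notin> X" and Y: "Y \<subseteq> X"
    and n: "card X \<le> n" "1 \<le> n" and q: "1 \<le> q" "n < q ^ J" and c: "0 < c" "c \<le> 1"
    and H: "harm (card X * card X) \<le> H" "1 \<le> H"
    and reg: "\<And>x j. x \<in> Y \<Longrightarrow> j < J \<Longrightarrow> 1 \<le> c * card (popular_pairs (q ^ j) X) \<Longrightarrow>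
      c * card (popular_pairs (q ^ j) X) / n \<le> card {a\<in>X. q ^ j \<le> diff_rep X (x - a)}"
  shows "(\<Sum>\<mu>\<in>ratios Y. (real (dilate_weight X Y \<mu>))\<^sup>2)
    \<le> (1 + real J * real J * 100000) * (q\<^sup>2 * H\<^sup>2 * n powr (13/3) / c ^ 4)"
proof -
  have finY: "finite Y" and Y0: "0 \<notin> Y" using X0 fin Y finite_subset by auto
  have finR: "finite (ratios Y)" and R0: "0 \<notin> ratios Y" using finY Y0 by (auto simp: ratios_def)
  define V where "V = q\<^sup>2 * H\<^sup>2 * n powr (13/3) / c ^ 4"
  define F where "F = (\<lambda>j \<mu>. \<Sum>u\<in>overlap X Y (q ^ j) q \<mu>. real (diff_rep X ((\<mu> - 1) * u)))"
  let ?R = "ratios Y - {1}"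
  have split: "real (dilate_weight X Y \<mu>) \<le> (\<Sum>j<J. F j \<mu>)" for \<mu>
  proof -
    let ?U = "{u\<in>Y. \<mu> * u \<in> Y}"
    let ?r = "\<lambda>u. real (diff_rep X ((\<mu> - 1) * u))"
    have "real (dilate_weight X Y \<mu>) \<le> (\<Sum>u\<in>?U. \<Sum>j<J. if u \<in> overlap X Y (q ^ j) q \<mu> then ?r u else 0)"
      unfolding dilate_weight_def of_nat_sum
    proof (rule sum_mono)
      fix u assume u: "u \<in> ?U"
      \<comment> \<open>The pair \<open>\<mu> * u\<close>, \<open>u\<close> itself represents the
        difference, so the count is at least 1 and falls into a window.\<close>
      have "\<mu> * u \<in> {a\<in>X. a - (\<mu> - 1) * u \<in> X}" using u Y by (auto simp: left_diff_distrib)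
      then have "0 < diff_rep X ((\<mu> - 1) * u)" unfolding diff_rep_def using fin by (subst card_gt_0_iff) auto
      then have "1 \<le> ?r u" by simp
      moreover have "?r u < q ^ J"
        using of_nat_mono[OF diff_rep_le[OF fin, of "(\<mu> - 1) * u"], where 'a = real] n q by linarith
      ultimately obtain j where j: "j < J" "q ^ j \<le> ?r u" "?r u < q * q ^ j"
        using geometric_level by blast
      then have "?r u = (if u \<in> overlap X Y (q ^ j) q \<mu> then ?r u else 0)" using u by (simp add: overlap_def)
      also have "\<dots> \<le> (\<Sum>j<J. if u \<in> overlap X Y (q ^ j) q \<mu> then ?r u else 0)"
        using j(1) by (intro member_le_sum[of j "{..<J}"]) auto
      finally show "?r u \<le> (\<Sum>j<J. if u \<in> overlap X Y (q ^ j) q \<mu> then ?r u else 0)" .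
    qed
    also have "\<dots> = (\<Sum>j<J. \<Sum>u\<in>?U. if u \<in> overlap X Y (q ^ j) q \<mu> then ?r u else 0)" by (rule sum.swap)
    also have "\<dots> = (\<Sum>j<J. F j \<mu>)"
    proof (intro sum.cong refl)
      fix j
      have "(\<Sum>u\<in>?U. if u \<in> overlap X Y (q ^ j) q \<mu> then ?r u else 0) = (\<Sum>u\<in>?U \<inter> overlap X Y (q ^ j) q \<mu>. ?r u)"
        using finY by (intro sum.inter_restrict[symmetric]) auto
      also have "?U \<inter> overlap X Y (q ^ j) q \<mu> = overlap X Y (q ^ j) q \<mu>" by (auto simp: overlap_def)
      finally show "(\<Sum>u\<in>?U. if u \<in> overlap X Y (q ^ j) q \<mu> then ?r u else 0) = F j \<mu>" by (simp only: F_def)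
    qed
    finally show ?thesis .
  qed
  have "(\<Sum>\<mu>\<in>?R. (real (dilate_weight X Y \<mu>))\<^sup>2) \<le> (\<Sum>\<mu>\<in>?R. (\<Sum>j<J. (F j \<mu>)\<^sup>2) * J)"
  proof (rule sum_mono)
    fix \<mu>
    have "(real (dilate_weight X Y \<mu>))\<^sup>2 \<le> (\<Sum>j<J. F j \<mu>)\<^sup>2" using split by (intro power_mono) auto
    also have "\<dots> \<le> (\<Sum>j<J. (F j \<mu>)\<^sup>2) * card {..<J}" by (rule sum_squared_le_sum_of_squares)
    finally show "(real (dilate_weight X Y \<mu>))\<^sup>2 \<le> (\<Sum>j<J. (F j \<mu>)\<^sup>2) * J" by simp
  qed
  also have "\<dots> = J * (\<Sum>j<J. \<Sum>\<mu>\<in>?R. (F j \<mu>)\<^sup>2)"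
    by (subst sum.swap) (simp add: sum_distrib_left mult.commute)
  also have "\<dots> \<le> J * (\<Sum>j<J. 100000 * V)"
  proof (intro mult_left_mono sum_mono)
    fix j assume j: "j \<in> {..<J}"
    have "(\<Sum>\<mu>\<in>?R. (F j \<mu>)\<^sup>2) \<le> 100000 * q\<^sup>2 * H\<^sup>2 * n powr (13/3) / c ^ 4"
      unfolding F_def
      by (rule level_energy_bound) (use fin X0 Y finR R0 n q c H reg j in \<open>auto simp: one_le_power\<close>)
    then show "(\<Sum>\<mu>\<in>?R. (F j \<mu>)\<^sup>2) \<le> 100000 * V" by (simp add: V_def mult.assoc)
  qed auto
  finally have main: "(\<Sum>\<mu>\<in>?R. (real (dilate_weight X Y \<mu>))\<^sup>2) \<le> real J * real J * 100000 * V" by simp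
  \<comment> \<open>For \<open>\<mu> = 1\<close> the difference is always 0, and the trivial bound
    \<open>n ^ 4\<close> for the squared weight suffices.\<close>
  have one: "(real (dilate_weight X Y 1))\<^sup>2 \<le> V"
  proof -
    have "dilate_weight X Y 1 = card Y * card X" by (simp add: dilate_weight_def diff_rep_def)
    also have "\<dots> \<le> card X * card X" using Y fin by (intro mult_right_mono card_mono) auto
    finally have "real (dilate_weight X Y 1) \<le> real (card X) * real (card X)" by (metis of_nat_le_iff of_nat_mult)
    also have "\<dots> \<le> n * n" using n by (intro mult_mono) auto
    finally have "(real (dilate_weight X Y 1))\<^sup>2 \<le> (n * n)\<^sup>2" by (intro power_mono) auto
    also have "(n * n)\<^sup>2 = n powr 4" using n by (simp add: power2_eq_square power4_eq_xxxx mult_ac)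
    also have "\<dots> \<le> n powr (13/3)" using n by (intro powr_mono) auto
    also have "\<dots> = 1 * 1 * n powr (13/3) * 1" by simp
    also have "\<dots> \<le> q\<^sup>2 * H\<^sup>2 * n powr (13/3) * (1 / c ^ 4)"
      using q H c by (intro mult_mono) (auto simp: one_le_power power_le_one)
    finally show ?thesis by (simp add: V_def)
  qed
  have "(\<Sum>\<mu>\<in>ratios Y. (real (dilate_weight X Y \<mu>))\<^sup>2) \<le> (\<Sum>\<mu>\<in>insert 1 ?R. (real (dilate_weight X Y \<mu>))\<^sup>2)"
    using finR by (intro sum_mono2) auto
  also have "\<dots> = (real (dilate_weight X Y 1))\<^sup>2 + (\<Sum>\<mu>\<in>?R. (real (dilate_weight X Y \<mu>))\<^sup>2)"
    using finR by (subst sum.insert) auto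
  also have "\<dots> \<le> (1 + real J * real J * 100000) * V"
    using one main by (simp add: algebra_simps)
  finally show ?thesis by (simp add: V_def)
qed

section \<open>The lower bound\<close>

lemma heis_prod_triples_mono:
  "X \<subseteq> A \<Longrightarrow> Y \<subseteq> B \<Longrightarrow> heis_prod_triples X Y \<subseteq> heis_prod_triples A B"
  unfolding heis_prod_triples_def by (intro image_mono Sigma_mono) auto

lemma finite_heis_prod_triples [simp]: "finite A \<Longrightarrow> finite B \<Longrightarrow> finite (heis_prod_triples A B)"
  by (simp add: heis_prod_triples_def)

text \<open>The ideal exponent is \<open>8 - 13/3 = 11/3\<close>. The losses are
  \<open>1/100\<close> from \<open>q^2\<close>, \<open>1/200\<close> from \<open>H^2\<close> and
  \<open>1/200\<close> from passing to \<open>X\<close>, together \<open>1/50\<close>, which stays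
  above \<open>29/8\<close>.\<close>

lemma heis_prod_triples_lower_bound:
  "\<exists>K>0. \<forall>A :: complex set. finite A \<longrightarrow> A \<noteq> {} \<longrightarrow> 0 \<notin> A \<longrightarrow>
    real (card A) powr (29/8) \<le> K * real (card (heis_prod_triples A A))"
proof -
  \<comment> \<open>A constant number of scales keeps \<open>c\<close> constant. \<open>M\<close> is
    so large compared with \<open>J\<close> that the size lost in passing to \<open>X\<close> is a
    tiny power of \<open>n\<close>.\<close>
  define J M :: nat where "J = 200" and "M = 640000"
  have J: "0 < J" and M: "0 < M" and JM: "real J * (8 / real M) = 1/400" by (simp_all add: J_def M_def)
  define c where "c = 1 / (2 * (2 * real J) ^ M)"
  have c: "0 < c" "c \<le> 1"
  proof -
    have "1 \<le> (2 * real J) ^ M" using J by (intro one_le_power) auto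
    then show "0 < c" "c \<le> 1" by (auto simp: c_def)
  qed
  \<comment> \<open>Of \<open>32 = 16 * 2\<close>, the 16 comes from
    \<open>card X \<le> 2 * card Y\<close> to the fourth power and the 2 from \<open>n8\<close>. The
    2 in the last factor comes from \<open>q2\<close>, and \<open>801\<^sup>2\<close> from
    \<open>H2\<close>.\<close>
  define K where "K = 32 * (1 + real J * real J * 100000) * (2 * 801\<^sup>2 / c ^ 4)"
  have K: "0 < K" using c by (simp add: K_def add_pos_nonneg)
  show ?thesis
  proof (intro exI[of _ K] conjI allI impI K)
    fix A :: "complex set" assume A: "finite A" "A \<noteq> {}" "0 \<notin> A"
    define n where "n = real (card A)"
    have n: "1 \<le> n" using A by (simp add: n_def Suc_le_eq card_gt_0_iff)
    \<comment> \<open>The factor 2 makes \<open>q ^ J = 2 * n\<close> strictly larger than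
      \<open>n\<close>.\<close>
    define q where "q = (2 * n) powr (1/200)"
    have q: "1 \<le> q" using n by (auto simp: q_def intro!: ge_one_powr_ge_zero)
    have qJ: "n < q ^ J" 
    proof -
      have "q ^ J = q powr real J" using q by (simp add: powr_realpow)
      also have "\<dots> = (2 * n) powr (1/200 * real J)" by (simp only: q_def powr_powr)
      also have "\<dots> = 2 * n" using n by (simp add: J_def)
      finally show ?thesis using n by simp
    qed
    define e where "e = (\<lambda>j X. card (popular_pairs (q ^ j) X))"
    define deg where "deg = (\<lambda>j X x. card {a\<in>X. q ^ j \<le> diff_rep X (x - a)})"
    have mono: "e j Z \<le> e j X" and deg: "e j Z \<le> (\<Sum>x\<in>Z. deg j X x)"
      if ZX: "Z \<subseteq> X" "X \<subseteq> A" for j Z X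
    proof -
      have fin: "finite X" using ZX(2) A(1) by (rule finite_subset)
      have finZ: "finite Z" using ZX(1) fin by (rule finite_subset)
      show "e j Z \<le> e j X" unfolding e_def
        using fin ZX by (intro card_mono popular_pairs_mono) auto
      have "popular_pairs (q ^ j) Z \<subseteq> (SIGMA x:Z. {a\<in>X. q ^ j \<le> diff_rep X (x - a)})"
        using popular_pairs_mono[OF fin ZX(1), of "q ^ j"] popular_pairs_subset[of "q ^ j" Z]
        by (auto simp: popular_pairs_def)
      then have "e j Z \<le> card (SIGMA x:Z. {a\<in>X. q ^ j \<le> diff_rep X (x - a)})"
        unfolding e_def using fin finZ by (intro card_mono finite_SigmaI) auto
      then show "e j Z \<le> (\<Sum>x\<in>Z. deg j X x)" using fin finZ by (simp add: deg_def)
    qed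
    obtain X Y where XY: "X \<subseteq> A" "X \<noteq> {}" "Y \<subseteq> X" "card X \<le> 2 * card Y"
      and size: "real (card A) ^ M \<le> real (card X) ^ M * (\<Prod>j<J. 1 + real (e j A))"
      and reg: "\<forall>j<J. \<forall>x\<in>Y. 1 \<le> c * e j X \<longrightarrow> c * e j X / card X \<le> deg j X x"
      by (rule regular_subset[where e = e and deg = deg, OF A(1,2) c_def J])
        (erule (1) mono, erule (1) deg, rule that)
    have finX: "finite X" using XY(1) A(1) by (rule finite_subset)
    define x where "x = real (card X)"
    have x: "1 \<le> x" "x \<le> n" using XY finX A by (auto simp: x_def n_def Suc_le_eq card_gt_0_iff intro: card_mono)
    define H where "H = 801 * n powr (1/400)"
    have n400: "1 \<le> n powr (1/400)" using n by (intro ge_one_powr_ge_zero) auto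
    have H: "harm (card X * card X) \<le> H" "1 \<le> H"
      using harm_square_le[of "card X" n] x n400 by (auto simp: H_def x_def)
    define P where "P = real (card (heis_prod_triples A A))"
    have P0: "0 \<le> P" by (simp add: P_def)
    define E where "E = (\<Sum>\<mu>\<in>ratios Y. (real (dilate_weight X Y \<mu>))\<^sup>2)"
    have E: "E \<le> (1 + real J * real J * 100000) * (q\<^sup>2 * H\<^sup>2 * n powr (13/3) / c ^ 4)"
      unfolding E_def
    proof (rule dilate_energy_bound)
      fix z j assume h: "z \<in> Y" "j < J" "1 \<le> c * card (popular_pairs (q ^ j) X)"
      have "c * card (popular_pairs (q ^ j) X) / n \<le> c * card (popular_pairs (q ^ j) X) / card X"
        using x c n by (intro divide_left_mono) (auto simp: x_def)
      also have "\<dots> \<le> card {a\<in>X. q ^ j \<le> diff_rep X (z - a)}"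
        using reg h by (simp add: e_def deg_def)
      finally show "c * card (popular_pairs (q ^ j) X) / n \<le> card {a\<in>X. q ^ j \<le> diff_rep X (z - a)}" .
    qed (use finX XY A n x q qJ c H in \<open>auto simp: x_def\<close>)
    have q2: "q\<^sup>2 \<le> 2 * n powr (1/100)"
    proof -
      have "q\<^sup>2 = 2 powr (1/100) * n powr (1/100)" using n by (simp add: q_def powr_power powr_mult power_mult_distrib)
      also have "2 powr (1/100) \<le> (2 :: real) powr 1" by (intro powr_mono) auto
      finally show ?thesis using n by simp
    qed
    have H2: "H\<^sup>2 = 801\<^sup>2 * n powr (1/200)" using n by (simp add: H_def power_mult_distrib powr_power)
    have prodle: "(\<Prod>j<J. 1 + real (e j A)) \<le> (2 * n\<^sup>2) ^ J"
    proof -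
      have "(\<Prod>j<J. 1 + real (e j A)) \<le> (\<Prod>j<J. 2 * n\<^sup>2)"
      proof (rule prod_mono, intro conjI)
        fix j
        have "real (e j A) \<le> n\<^sup>2"
          using of_nat_mono[OF card_popular_pairs_le[OF A(1), of "q ^ j"], where 'a = real]
          by (simp add: e_def n_def power2_eq_square)
        moreover have "1 \<le> n\<^sup>2" using n by (simp add: one_le_power)
        ultimately show "1 + real (e j A) \<le> 2 * n\<^sup>2" by linarith
      qed simp
      then show ?thesis by simp
    qed
    \<comment> \<open>The power \<open>8 / M\<close> of \<open>size\<close> turns the product bound
      \<open>(2 * n\<^sup>2) ^ J\<close> into \<open>(2 * n\<^sup>2) powr (1/400)\<close>.\<close>
    have n8: "n powr 8 \<le> x powr 8 * (2 * n powr (1/200))"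
    proof -
      have "n powr M \<le> x powr M * (2 * n\<^sup>2) powr J"
      proof -
        have "n ^ M \<le> x ^ M * (\<Prod>j<J. 1 + real (e j A))" using size by (simp add: n_def x_def)
        also have "\<dots> \<le> x ^ M * (2 * n\<^sup>2) ^ J" using prodle x by (intro mult_left_mono) auto
        finally show ?thesis using n x by (simp add: powr_realpow)
      qed
      then have "(n powr M) powr (8 / M) \<le> (x powr M * (2 * n\<^sup>2) powr J) powr (8 / M)"
        by (intro powr_mono2) auto
      also have "\<dots> = x powr 8 * (2 * n\<^sup>2) powr (1/400)"
        unfolding powr_mult[of "x powr M"] powr_powr JM using M by simp
      also have "(2 * n\<^sup>2) powr (1/400) = 2 powr (1/400) * (n powr 2) powr (1/400)" using n by (simp add: powr_mult)
      also have "(n powr 2) powr (1/400) = n powr (1/200)" by (simp only: powr_powr) simp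
      also have "x powr 8 * (2 powr (1/400) * n powr (1/200)) \<le> x powr 8 * (2 powr 1 * n powr (1/200))"
        by (intro mult_left_mono mult_right_mono powr_mono) auto
      finally show ?thesis using M by (simp add: powr_powr)
    qed
    have "x powr 8 = x ^ 4 * x ^ 4" using x by (simp flip: power_add)
    also have "\<dots> \<le> x ^ 4 * (2 * real (card Y)) ^ 4"
      using XY(4) x by (intro mult_left_mono power_mono) (auto simp: x_def)
    also have "\<dots> = 16 * (real (card X) * real (card Y)) ^ 4" by (simp add: x_def power_mult_distrib)
    also have "(real (card X) * real (card Y)) ^ 4 \<le> real (card (heis_prod_triples X Y)) * E"
      unfolding E_def using finX XY A by (intro heis_prod_triples_energy) auto
    also have "real (card (heis_prod_triples X Y)) * E \<le> P * E"
      unfolding P_def E_def using XY A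
      by (intro mult_right_mono of_nat_mono card_mono heis_prod_triples_mono sum_nonneg) auto
    finally have x8: "x powr 8 \<le> 16 * (P * E)" by simp
    have "E \<le> (1 + real J * real J * 100000) * ((2 * n powr (1/100)) * (801\<^sup>2 * n powr (1/200)) * n powr (13/3) / c ^ 4)"
      by (rule order_trans[OF E], unfold H2, intro mult_left_mono divide_right_mono mult_right_mono q2) (use c in auto)
    also have "\<dots> = K / 32 * (n powr (1/100) * n powr (1/200) * n powr (13/3))"
    proof -
      have "a * ((2 * x) * (801\<^sup>2 * y) * z / d) = 32 * a * (2 * 801\<^sup>2 / d) / 32 * (x * y * z)" for a x y z d :: real
        by simp
      then show ?thesis unfolding K_def .
    qed
    finally have E': "E \<le> K / 32 * (n powr (1/100) * n powr (1/200) * n powr (13/3))" .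
    have "n powr 8 \<le> 16 * (P * E) * (2 * n powr (1/200))"
      using n8 x8 n by (meson mult_right_mono order_trans powr_ge_zero mult_nonneg_nonneg zero_le_numeral)
    also have "\<dots> = 32 * P * n powr (1/200) * E" by simp
    also have "\<dots> \<le> 32 * P * n powr (1/200) * (K / 32 * (n powr (1/100) * n powr (1/200) * n powr (13/3)))"
      using E' P0 by (intro mult_left_mono) auto
    also have "\<dots> = K * P * (n powr (1/200) * n powr (1/100) * n powr (1/200) * n powr (13/3))" by simp
    also have "\<dots> = K * P * n powr (13/3 + 1/50)" by (simp flip: powr_add)
    finally have "n powr 8 \<le> K * P * n powr (13/3 + 1/50)" .
    moreover have "n powr (29/8) * n powr (13/3 + 1/50) \<le> n powr 8"
      unfolding powr_add[symmetric] using n by (intro powr_mono) auto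
    ultimately have "n powr (29/8) * n powr (13/3 + 1/50) \<le> K * P * n powr (13/3 + 1/50)" by linarith
    then have "n powr (29/8) \<le> K * P" using n by simp
    then show "real (card A) powr (29/8) \<le> K * real (card (heis_prod_triples A A))" by (simp add: n_def P_def)
  qed
qed

section \<open>From triples back to matrices\<close>

lemma heis_eq_iff: "heis x y z = heis x' y' z' \<longleftrightarrow> x = x' \<and> y = y' \<and> z = z'"
  by (auto simp: heis_def vec_eq_iff forall_3)

lemma card_heis_slice: "card (heis_slice A) = card A * card A"
proof -
  have "heis_slice A = (\<lambda>(x, y). heis x y 0) ` (A \<times> A)" by (auto simp: heis_slice_def)
  then show ?thesis
    by (simp add: card_image inj_on_def heis_eq_iff card_cartesian_product)
qed

lemma card_heis_slice_prod:
  "card (mat_set_prod (heis_slice A) (heis_slice A)) = card (heis_prod_triples A A)"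
proof -
  have "mat_set_prod (heis_slice A) (heis_slice A) = (\<lambda>(s, t, p). heis s t p) ` heis_prod_triples A A"
  proof (intro equalityI subsetI)
    fix z assume "z \<in> mat_set_prod (heis_slice A) (heis_slice A)"
    then obtain x y x' y' where h: "x \<in> A" "y \<in> A" "x' \<in> A" "y' \<in> A" and z: "z = heis x y 0 ** heis x' y' 0"
      by (auto simp: mat_set_prod_def heis_slice_def)
    have "(x + x', y + y', x * y') \<in> heis_prod_triples A A"
      unfolding heis_prod_triples_def using h by (intro image_eqI[of _ _ "(x, x', y, y')"]) auto
    then show "z \<in> (\<lambda>(s, t, p). heis s t p) ` heis_prod_triples A A"
      by (rule rev_image_eqI) (simp add: z heis_mult)
  next
    fix z assume "z \<in> (\<lambda>(s, t, p). heis s t p) ` heis_prod_triples A A"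
    then obtain x x' y y' where h: "x \<in> A" "y \<in> A" "x' \<in> A" "y' \<in> A" and z: "z = heis (x + x') (y + y') (x * y')"
      by (auto simp: heis_prod_triples_def)
    have "z = heis x y 0 ** heis x' y' 0" by (simp add: z heis_mult)
    then show "z \<in> mat_set_prod (heis_slice A) (heis_slice A)"
      using h unfolding mat_set_prod_def heis_slice_def by blast
  qed
  moreover have "inj_on (\<lambda>(s, t, p). heis s t p) (heis_prod_triples A A)"
    by (auto simp: inj_on_def heis_eq_iff)
  ultimately show ?thesis by (simp add: card_image)
qed

text \<open>Fixing \<open>x = y' = a\<close> and varying the other two entries gives distinct
  triples. This serves to bound the logarithm in the theorem from below.\<close>

lemma card_square_le_heis_prod_triples:
  assumes "finite A" "A \<noteq> {}"
  shows "card A * card A \<le> card (heis_prod_triples A A)"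
proof -
  obtain a where a: "a \<in> A" using assms by auto
  have "card (A \<times> A) \<le> card (heis_prod_triples A A)"
  proof (rule card_inj_on_le[where f = "\<lambda>(x', y). (a + x', y + a, a * a)"])
    show "(\<lambda>(x', y). (a + x', y + a, a * a)) ` (A \<times> A) \<subseteq> heis_prod_triples A A"
      using a by (force simp: heis_prod_triples_def)
  qed (use assms in \<open>auto simp: inj_on_def\<close>)
  then show ?thesis by (simp add: card_cartesian_product)
qed

theorem theorem1p9:
  shows "\<exists>C>0. \<exists>C'>0. \<forall>A :: complex set. finite A \<and> card A \<ge> 2 \<longrightarrow>
    real (card A) powr (29/8)
      \<le> C * ln (real (card (mat_set_prod (heis_slice A) (heis_slice A)))) powr C'
          * real (card (mat_set_prod (heis_slice A) (heis_slice A)))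
    \<and> real (card A) powr (29/8) = real (card (heis_slice A)) powr (29/16)"
proof -
  obtain K where K: "K > 0" and bound: "\<And>A :: complex set. finite A \<Longrightarrow> A \<noteq> {} \<Longrightarrow> 0 \<notin> A \<Longrightarrow>
    real (card A) powr (29/8) \<le> K * real (card (heis_prod_triples A A))"
    using heis_prod_triples_lower_bound by blast
  have "real (card A) powr (29/8) \<le> (2 powr (29/8) * K) * ln (real (card (heis_prod_triples A A))) powr 1
      * real (card (heis_prod_triples A A))"
    and "real (card A) powr (29/8) = real (card A * card A) powr (29/16)"
    if A: "finite A" "card A \<ge> 2" for A :: "complex set"
  proof -
    let ?P = "real (card (heis_prod_triples A A))"
    let ?B = "A - {0}"
    \<comment> \<open>Removing 0 at most halves a set with two or more elements.\<close>
    have cB: "card A \<le> 2 * card ?B" using A by (cases "0 \<in> A") auto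
    then have B: "?B \<noteq> {}" using A by (metis card.empty mult_0_right not_numeral_le_zero order_trans)
    have "4 \<le> card A * card A" using mult_le_mono[OF A(2) A(2)] by simp
    also have "\<dots> \<le> card (heis_prod_triples A A)"
      using A by (intro card_square_le_heis_prod_triples) auto
    finally have P4: "4 \<le> ?P" by simp
    have "exp 1 \<le> ?P" using P4 exp_le by linarith
    then have lnP: "1 \<le> ln ?P" using P4 by (simp add: ln_ge_iff)
    have "real (card A) powr (29/8) \<le> (2 * real (card ?B)) powr (29/8)"
      using of_nat_mono[OF cB, where 'a = real] by (intro powr_mono2) auto
    also have "\<dots> = 2 powr (29/8) * real (card ?B) powr (29/8)" by (simp add: powr_mult)
    also have "\<dots> \<le> 2 powr (29/8) * (K * real (card (heis_prod_triples ?B ?B)))"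
      using A B by (intro mult_left_mono bound) auto
    also have "\<dots> \<le> 2 powr (29/8) * (K * ?P)"
      using A K by (intro mult_left_mono of_nat_mono card_mono heis_prod_triples_mono) auto
    also have "\<dots> = (2 powr (29/8) * K) * 1 * ?P" by simp
    \<comment> \<open>The product set has at least \<open>4 > exp 1\<close> elements, so inserting
      its logarithm only increases the right side; hence the witness \<open>C' = 1\<close>.\<close>
    also have "\<dots> \<le> (2 powr (29/8) * K) * ln ?P powr 1 * ?P"
      using lnP K by (intro mult_right_mono mult_left_mono) auto
    finally show "real (card A) powr (29/8) \<le> (2 powr (29/8) * K) * ln ?P powr 1 * ?P" .
    have "real (card A * card A) = real (card A) powr 2" using A by (simp add: power2_eq_square)
    then show "real (card A) powr (29/8) = real (card A * card A) powr (29/16)"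
      by (simp only: powr_powr) simp
  qed
  then show ?thesis
    unfolding card_heis_slice card_heis_slice_prod using K
    by (intro exI[of _ "2 powr (29/8) * K"] exI[of _ 1] conjI allI impI) auto
qed

end
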